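(* Let $\Delta$ be the list of the following four definite clauses (each universally closed over its capitalized variables): $\mathrm{eval}\ (\mathrm{abs}\ A\ M)\ (\mathrm{abs}\ A\ M)$; $\mathrm{eval}\ M\ (\mathrm{abs}\ A\ R) \supset \mathrm{eval}\ (R\ N)\ V \supset \mathrm{eval}\ (\mathrm{app}\ M\ N)\ V$; $\mathrm{of}\ M\ (\mathrm{arr}\ A\ B) \supset \mathrm{of}\ N\ A \supset \mathrm{of}\ (\mathrm{app}\ M\ N)\ B$; $(\forall x.\ \mathrm{of}\ x\ A \supset \mathrm{of}\ (R\ x)\ B) \supset \mathrm{of}\ (\mathrm{abs}\ A\ R)\ (\mathrm{arr}\ A\ B)$. For terms $e, v$ of type $tm$ and $t$ of type $tp$: if $\Delta \vdash \mathrm{eval}\ e\ v$ holds and $\Delta \vdash \mathrm{of}\ e\ t$ holds in $\mathcal{HH}^2$, then $\Delta \vdash \mathrm{of}\ v\ t$ holds in $\mathcal{HH}^2$ (all three sequents over the same signature of eigenvariables, which the paper leaves implicit).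
   Context: The specification logic $\mathcal{HH}^2$: terms are simply typed $\lambda$-terms identified up to $\lambda$-conversion, formulas have type $o$; goal formulas $G ::= \top \mid A \mid A \supset G \mid \forall x.G \mid \exists x.G \mid G\land G \mid G \lor G$, definite clauses $D ::= A \mid G \supset D \mid \forall x.D$ (written as $\forall\vec x.(G_1\supset\cdots\supset G_m\supset A)$); sequents $\Sigma:\Delta\vdash G$ are derived with the rules TRUE, OR$_1$/OR$_2$, AND (usual right rules for $\top,\lor,\land$), INSTANCE (from $\Sigma:\Delta\vdash G[t/x]$ infer $\Sigma:\Delta\vdash\exists x.G$ for a well-typed $t$ over $\Sigma$), AUGMENT (from $\Sigma:\Delta,A\vdash G$ infer $\Sigma:\Delta\vdash A\supset G$), GENERIC (from $\Sigma\cup\{c\}:\Delta\vdash G[c/x]$, $c\notin\Sigma$, infer $\Sigma:\Delta\vdash\forall x.G$), BACKCHAIN (from $\Sigma:\Delta\vdash G_i[\vec t/\vec x]$, $i=1..m$, infer $\Sigma:\Delta\vdash A$ when $\forall\vec x.(G_1\supset\cdots\supset G_m\supset A')\in\Delta$ and $A'[\vec t/\vec x]=A$). The encoding of the simply-typed $\lambda$-calculus uses types $tp$ and $tm$, constants $i:tp$, $\mathrm{arr}:tp\to tp\to tp$, $\mathrm{app}:tm\to tm\to tm$, $\mathrm{abs}:tp\to(tm\to tm)\to tm$, and predicates $\mathrm{of}:tm\to tp\to o$ and $\mathrm{eval}:tm\to tm\to o$. *)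

theory Defs
  imports Main
begin

section \<open>Simply typed \<open>\<lambda>\<close>-terms up to \<open>\<lambda>\<close>-conversion\<close>

text \<open>
  The logic is parametric in the base types \<open>'b\<close> and the constants \<open>'c\<close>, the latter with a
  typing \<open>\<kappa> :: 'c \<Rightarrow> 'b ty\<close>. \<open>Prop\<close> is the type \<open>o\<close> of formulas.
\<close>

datatype 'b ty = Base 'b | Prop | Fn "'b ty" "'b ty" (infixr "\<rightarrow>" 60)

text \<open>
  Bound variables are de Bruijn indices (\<open>Bnd\<close>), eigenvariables are named by natural
  numbers (\<open>Eig\<close>), and abstractions carry the type of their variable.
\<close>

datatype ('c, 'b) trm =
    Const 'c
  | Eig nat
  | Bnd nat
  | App "('c, 'b) trm" "('c, 'b) trm" (infixl "\<bullet>" 100)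
  | Lam "'b ty" "('c, 'b) trm"

type_synonym 'b eigsig = "nat \<Rightarrow> 'b ty option"

inductive has_type ::
  "('c \<Rightarrow> 'b ty) \<Rightarrow> 'b eigsig \<Rightarrow> 'b ty list \<Rightarrow> ('c, 'b) trm \<Rightarrow> 'b ty \<Rightarrow> bool"
  for \<kappa> \<Sigma> where
  ty_Const: "has_type \<kappa> \<Sigma> \<Gamma> (Const c) (\<kappa> c)"
| ty_Eig: "\<Sigma> x = Some \<tau> \<Longrightarrow> has_type \<kappa> \<Sigma> \<Gamma> (Eig x) \<tau>"
| ty_Bnd: "n < length \<Gamma> \<Longrightarrow> has_type \<kappa> \<Sigma> \<Gamma> (Bnd n) (\<Gamma> ! n)"
| ty_App: "has_type \<kappa> \<Sigma> \<Gamma> M (\<sigma> \<rightarrow> \<tau>) \<Longrightarrow> has_type \<kappa> \<Sigma> \<Gamma> N \<sigma> \<Longrightarrow> has_type \<kappa> \<Sigma> \<Gamma> (M \<bullet> N) \<tau>"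
| ty_Lam: "has_type \<kappa> \<Sigma> (\<sigma> # \<Gamma>) M \<tau> \<Longrightarrow> has_type \<kappa> \<Sigma> \<Gamma> (Lam \<sigma> M) (\<sigma> \<rightarrow> \<tau>)"

primrec lift :: "nat \<Rightarrow> ('c, 'b) trm \<Rightarrow> ('c, 'b) trm" where
  "lift k (Const c) = Const c"
| "lift k (Eig x) = Eig x"
| "lift k (Bnd n) = (if n < k then Bnd n else Bnd (Suc n))"
| "lift k (M \<bullet> N) = lift k M \<bullet> lift k N"
| "lift k (Lam \<tau> M) = Lam \<tau> (lift (Suc k) M)"

text \<open>\<open>subst k s M\<close> replaces index \<open>k\<close> by \<open>s\<close> and lowers the larger indices.\<close>

primrec subst :: "nat \<Rightarrow> ('c, 'b) trm \<Rightarrow> ('c, 'b) trm \<Rightarrow> ('c, 'b) trm" where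
  "subst k s (Const c) = Const c"
| "subst k s (Eig x) = Eig x"
| "subst k s (Bnd n) = (if n < k then Bnd n else if n = k then s else Bnd (n - 1))"
| "subst k s (M \<bullet> N) = subst k s M \<bullet> subst k s N"
| "subst k s (Lam \<tau> M) = Lam \<tau> (subst (Suc k) (lift 0 s) M)"

inductive step :: "('c, 'b) trm \<Rightarrow> ('c, 'b) trm \<Rightarrow> bool" where
  step_beta: "step (Lam \<tau> M \<bullet> N) (subst 0 N M)"
| step_eta: "step (Lam \<tau> (lift 0 M \<bullet> Bnd 0)) M"
| step_AppL: "step M M' \<Longrightarrow> step (M \<bullet> N) (M' \<bullet> N)"
| step_AppR: "step N N' \<Longrightarrow> step (M \<bullet> N) (M \<bullet> N')"
| step_Lam: "step M M' \<Longrightarrow> step (Lam \<tau> M) (Lam \<tau> M')"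

text \<open>
  \<open>\<lambda>\<close>-conversion between terms of the same type over the same signature. The intermediate terms
  must be well typed as well: on ill-typed terms, \<open>\<beta>\<eta>\<close> with annotated abstractions would
  identify \<open>Lam \<sigma> (Bnd 0)\<close> and \<open>Lam \<tau> (Bnd 0)\<close>.
\<close>

definition conv ::
  "('c \<Rightarrow> 'b ty) \<Rightarrow> 'b eigsig \<Rightarrow> 'b ty \<Rightarrow> ('c, 'b) trm \<Rightarrow> ('c, 'b) trm \<Rightarrow> bool" where
  "conv \<kappa> \<Sigma> \<tau> M N \<longleftrightarrow>
     has_type \<kappa> \<Sigma> [] M \<tau> \<and> has_type \<kappa> \<Sigma> [] N \<tau> \<and>
     equivclp (\<lambda>P Q. has_type \<kappa> \<Sigma> [] P \<tau> \<and> has_type \<kappa> \<Sigma> [] Q \<tau> \<and> step P Q) M N"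

section \<open>The logic HH2\<close>

text \<open>Atomic formulas are terms of type \<open>Prop\<close>; quantifiers bind index \<open>0\<close>.\<close>

datatype ('c, 'b) gform =
    Top
  | Atom "('c, 'b) trm"
  | Imp "('c, 'b) trm" "('c, 'b) gform"
  | All "'b ty" "('c, 'b) gform"
  | Ex "'b ty" "('c, 'b) gform"
  | And "('c, 'b) gform" "('c, 'b) gform"
  | Or "('c, 'b) gform" "('c, 'b) gform"

datatype ('c, 'b) clause =
    CAtom "('c, 'b) trm"
  | CImp "('c, 'b) gform" "('c, 'b) clause"
  | CAll "'b ty" "('c, 'b) clause"

primrec subst_gform :: "nat \<Rightarrow> ('c, 'b) trm \<Rightarrow> ('c, 'b) gform \<Rightarrow> ('c, 'b) gform" where
  "subst_gform k s Top = Top"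
| "subst_gform k s (Atom A) = Atom (subst k s A)"
| "subst_gform k s (Imp A G) = Imp (subst k s A) (subst_gform k s G)"
| "subst_gform k s (All \<tau> G) = All \<tau> (subst_gform (Suc k) (lift 0 s) G)"
| "subst_gform k s (Ex \<tau> G) = Ex \<tau> (subst_gform (Suc k) (lift 0 s) G)"
| "subst_gform k s (And G H) = And (subst_gform k s G) (subst_gform k s H)"
| "subst_gform k s (Or G H) = Or (subst_gform k s G) (subst_gform k s H)"

primrec subst_clause :: "nat \<Rightarrow> ('c, 'b) trm \<Rightarrow> ('c, 'b) clause \<Rightarrow> ('c, 'b) clause" where
  "subst_clause k s (CAtom A) = CAtom (subst k s A)"
| "subst_clause k s (CImp G D) = CImp (subst_gform k s G) (subst_clause k s D)"
| "subst_clause k s (CAll \<tau> D) = CAll \<tau> (subst_clause (Suc k) (lift 0 s) D)"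

text \<open>
  \<open>clause_inst \<kappa> \<Sigma> D Gs A\<close>: instantiating the universal quantifiers of \<open>D\<close> with well-typed terms
  over \<open>\<Sigma>\<close> yields \<open>G\<^sub>1 \<supset> \<dots> \<supset> G\<^sub>m \<supset> A\<close> where \<open>Gs = [G\<^sub>1, \<dots>, G\<^sub>m]\<close>.
\<close>

inductive clause_inst ::
  "('c \<Rightarrow> 'b ty) \<Rightarrow> 'b eigsig \<Rightarrow> ('c, 'b) clause \<Rightarrow> ('c, 'b) gform list \<Rightarrow> ('c, 'b) trm \<Rightarrow> bool"
  for \<kappa> \<Sigma> where
  inst_Atom: "clause_inst \<kappa> \<Sigma> (CAtom A) [] A"
| inst_Imp: "clause_inst \<kappa> \<Sigma> D Gs A \<Longrightarrow> clause_inst \<kappa> \<Sigma> (CImp G D) (G # Gs) A"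
| inst_All: "has_type \<kappa> \<Sigma> [] t \<tau> \<Longrightarrow> clause_inst \<kappa> \<Sigma> (subst_clause 0 t D) Gs A \<Longrightarrow>
    clause_inst \<kappa> \<Sigma> (CAll \<tau> D) Gs A"

text \<open>
  \<open>hh \<kappa> \<Sigma> \<Delta> G\<close> is derivability of the sequent \<open>\<Sigma> : \<Delta> \<turnstile> G\<close>. Only backchaining compares
  formulas, so the identification of terms up to \<open>\<lambda>\<close>-conversion matters only there.
\<close>

inductive hh ::
  "('c \<Rightarrow> 'b ty) \<Rightarrow> 'b eigsig \<Rightarrow> ('c, 'b) clause list \<Rightarrow> ('c, 'b) gform \<Rightarrow> bool"
  for \<kappa> where
  TRUE: "hh \<kappa> \<Sigma> \<Delta> Top"
| OR1: "hh \<kappa> \<Sigma> \<Delta> G \<Longrightarrow> hh \<kappa> \<Sigma> \<Delta> (Or G H)"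
| OR2: "hh \<kappa> \<Sigma> \<Delta> H \<Longrightarrow> hh \<kappa> \<Sigma> \<Delta> (Or G H)"
| AND: "hh \<kappa> \<Sigma> \<Delta> G \<Longrightarrow> hh \<kappa> \<Sigma> \<Delta> H \<Longrightarrow> hh \<kappa> \<Sigma> \<Delta> (And G H)"
| INSTANCE: "has_type \<kappa> \<Sigma> [] t \<tau> \<Longrightarrow> hh \<kappa> \<Sigma> \<Delta> (subst_gform 0 t G) \<Longrightarrow> hh \<kappa> \<Sigma> \<Delta> (Ex \<tau> G)"
| AUGMENT: "hh \<kappa> \<Sigma> (CAtom A # \<Delta>) G \<Longrightarrow> hh \<kappa> \<Sigma> \<Delta> (Imp A G)"
| GENERIC: "c \<notin> dom \<Sigma> \<Longrightarrow> hh \<kappa> (\<Sigma>(c \<mapsto> \<tau>)) \<Delta> (subst_gform 0 (Eig c) G) \<Longrightarrow> hh \<kappa> \<Sigma> \<Delta> (All \<tau> G)"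
| BACKCHAIN: "D \<in> set \<Delta> \<Longrightarrow> clause_inst \<kappa> \<Sigma> D Gs A' \<Longrightarrow> conv \<kappa> \<Sigma> Prop A' A \<Longrightarrow>
    (\<forall>G \<in> set Gs. hh \<kappa> \<Sigma> \<Delta> G) \<Longrightarrow> hh \<kappa> \<Sigma> \<Delta> (Atom A)"

section \<open>Encoding of the simply typed \<open>\<lambda>\<close>-calculus\<close>

datatype stlc_base = Tp | Tm

datatype stlc_const = I_c | Arr_c | App_c | Abs_c | Of_c | Eval_c

abbreviation tp :: "stlc_base ty" where "tp \<equiv> Base Tp"
abbreviation tm :: "stlc_base ty" where "tm \<equiv> Base Tm"

primrec stlc_sig :: "stlc_const \<Rightarrow> stlc_base ty" where
  "stlc_sig I_c = tp"
| "stlc_sig Arr_c = tp \<rightarrow> tp \<rightarrow> tp"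
| "stlc_sig App_c = tm \<rightarrow> tm \<rightarrow> tm"
| "stlc_sig Abs_c = tp \<rightarrow> (tm \<rightarrow> tm) \<rightarrow> tm"
| "stlc_sig Of_c = tm \<rightarrow> tp \<rightarrow> Prop"
| "stlc_sig Eval_c = tm \<rightarrow> tm \<rightarrow> Prop"

type_synonym stlc_trm = "(stlc_const, stlc_base) trm"

abbreviation arr :: "stlc_trm \<Rightarrow> stlc_trm \<Rightarrow> stlc_trm" where
  "arr A B \<equiv> Const Arr_c \<bullet> A \<bullet> B"
abbreviation app :: "stlc_trm \<Rightarrow> stlc_trm \<Rightarrow> stlc_trm" where
  "app M N \<equiv> Const App_c \<bullet> M \<bullet> N"
abbreviation abs_tm :: "stlc_trm \<Rightarrow> stlc_trm \<Rightarrow> stlc_trm" where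
  "abs_tm A R \<equiv> Const Abs_c \<bullet> A \<bullet> R"
abbreviation of_tp :: "stlc_trm \<Rightarrow> stlc_trm \<Rightarrow> stlc_trm" where
  "of_tp M A \<equiv> Const Of_c \<bullet> M \<bullet> A"
abbreviation eval_tm :: "stlc_trm \<Rightarrow> stlc_trm \<Rightarrow> stlc_trm" where
  "eval_tm M V \<equiv> Const Eval_c \<bullet> M \<bullet> V"

definition eval_abs_clause :: "(stlc_const, stlc_base) clause" where
  "eval_abs_clause =
     (let A = Bnd 1; M = Bnd 0 in
      CAll tp (CAll (tm \<rightarrow> tm) (CAtom (eval_tm (abs_tm A M) (abs_tm A M)))))"

definition eval_app_clause :: "(stlc_const, stlc_base) clause" where
  "eval_app_clause =
     (let M = Bnd 4; A = Bnd 3; R = Bnd 2; N = Bnd 1; V = Bnd 0 in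
      CAll tm (CAll tp (CAll (tm \<rightarrow> tm) (CAll tm (CAll tm
        (CImp (Atom (eval_tm M (abs_tm A R)))
        (CImp (Atom (eval_tm (R \<bullet> N) V))
        (CAtom (eval_tm (app M N) V)))))))))"

definition of_app_clause :: "(stlc_const, stlc_base) clause" where
  "of_app_clause =
     (let M = Bnd 3; A = Bnd 2; B = Bnd 1; N = Bnd 0 in
      CAll tm (CAll tp (CAll tp (CAll tm
        (CImp (Atom (of_tp M (arr A B)))
        (CImp (Atom (of_tp N A))
        (CAtom (of_tp (app M N) B))))))))"

text \<open>The indices of \<open>A\<close>, \<open>R\<close>, \<open>B\<close> are one higher below the inner quantifier on \<open>x = Bnd 0\<close>.\<close>

definition of_abs_clause :: "(stlc_const, stlc_base) clause" where
  "of_abs_clause =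
     CAll tp (CAll (tm \<rightarrow> tm) (CAll tp
       (CImp
         (let x = Bnd 0; A = Bnd 3; R = Bnd 2; B = Bnd 1 in
          All tm (Imp (of_tp x A) (Atom (of_tp (R \<bullet> x) B))))
       (let A = Bnd 2; R = Bnd 1; B = Bnd 0 in
        CAtom (of_tp (abs_tm A R) (arr A B))))))"

definition stlc_clauses :: "(stlc_const, stlc_base) clause list" where
  "stlc_clauses = [eval_abs_clause, eval_app_clause, of_app_clause, of_abs_clause]"

end

theory Submission
  imports Defs
begin

text \<open>
  The induction is on the derivation of \<open>eval e v\<close>. Inverting the typing derivations needs that
  constants are injective and distinct up to \<open>\<lambda>\<close>-conversion. Instead of confluence, we use a binary
  logical relation that contains conversion as a conjunct at every type and that says at base types
  that both terms weak head reduce to the same rigid head applied to convertible arguments; it is a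
  partial equivalence relation, contains every typed conversion step, and hence all of conversion.
  In the case of \<open>app\<close>, the hypothetical and generic premise of the typing rule for \<open>abs\<close> is
  instantiated with the argument by substituting for the eigenvariable and cutting the hypothesis.
\<close>

section \<open>Typing and closed terms\<close>

inductive_cases has_type_ConstE: "has_type \<kappa> \<Sigma> \<Gamma> (Const c) \<tau>"
inductive_cases has_type_EigE: "has_type \<kappa> \<Sigma> \<Gamma> (Eig x) \<tau>"
inductive_cases has_type_BndE: "has_type \<kappa> \<Sigma> \<Gamma> (Bnd n) \<tau>"
inductive_cases has_type_AppE: "has_type \<kappa> \<Sigma> \<Gamma> (M \<bullet> N) \<tau>"
inductive_cases has_type_LamE: "has_type \<kappa> \<Sigma> \<Gamma> (Lam \<sigma> M) \<tau>"

text \<open>Annotated abstractions make the type a function of the term. Later this recovers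
  argument types that the rules for application leave hidden.\<close>

lemma has_type_unique:
  "has_type \<kappa> \<Sigma> \<Gamma> M \<tau> \<Longrightarrow> has_type \<kappa> \<Sigma> \<Gamma> M \<tau>' \<Longrightarrow> \<tau> = \<tau>'"
proof (induction arbitrary: \<tau>' rule: has_type.induct)
  case (ty_App \<Gamma> M \<sigma> \<tau> N)
  then show ?case by (blast elim: has_type_AppE)
next
  case (ty_Lam \<sigma> \<Gamma> M \<tau>)
  then show ?case by (blast elim: has_type_LamE)
qed (auto elim!: has_type_ConstE has_type_EigE has_type_BndE)

text \<open>Stated as invariance under lifting and substitution, not as absence of dangling indices,
  so that it can be used directly for rewriting.\<close>

definition closed :: "('c, 'b) trm \<Rightarrow> bool" where
  "closed M \<longleftrightarrow> (\<forall>k. lift k M = M) \<and> (\<forall>k s. subst k s M = M)"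

lemma closed_lift: "closed M \<Longrightarrow> lift k M = M"
  and closed_subst: "closed M \<Longrightarrow> subst k s M = M"
  by (simp_all add: closed_def)

lemma closed_Eig: "closed (Eig x)"
  by (simp add: closed_def)

text \<open>Indices in a term typed in \<open>\<Gamma>\<close> stay below
  \<open>length \<Gamma>\<close>. Allowing any \<open>k\<close> above that length lets the induction
  pass under binders.\<close>

lemma has_type_lift_subst_id:
  "has_type \<kappa> \<Sigma> \<Gamma> M \<tau> \<Longrightarrow> length \<Gamma> \<le> k \<Longrightarrow> lift k M = M \<and> subst k s M = M"
  by (induction arbitrary: k s rule: has_type.induct) auto

lemma has_type_closed: "has_type \<kappa> \<Sigma> [] M \<tau> \<Longrightarrow> closed M"
  unfolding closed_def using has_type_lift_subst_id by fastforce

lemma has_type_append: "has_type \<kappa> \<Sigma> \<Gamma> M \<tau> \<Longrightarrow> has_type \<kappa> \<Sigma> (\<Gamma> @ \<Gamma>') M \<tau>"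
proof (induction rule: has_type.induct)
  case (ty_Bnd n \<Gamma>)
  then show ?case
    using has_type.ty_Bnd[of n "\<Gamma> @ \<Gamma>'" \<kappa> \<Sigma>] by (simp add: nth_append)
qed (auto intro: has_type.intros)

lemma has_type_subst:
  assumes "has_type \<kappa> \<Sigma> (\<Gamma> @ \<sigma> # \<Gamma>') M \<tau>" and s: "has_type \<kappa> \<Sigma> [] s \<sigma>"
  shows "has_type \<kappa> \<Sigma> (\<Gamma> @ \<Gamma>') (subst (length \<Gamma>) s M) \<tau>"
  using assms(1)
proof (induction "\<Gamma> @ \<sigma> # \<Gamma>'" M \<tau> arbitrary: \<Gamma> rule: has_type.induct)
  case (ty_Bnd n)
  have *: "has_type \<kappa> \<Sigma> (\<Gamma> @ \<Gamma>') s \<sigma>" using has_type_append[OF s] by simp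
  consider "n < length \<Gamma>" | "n = length \<Gamma>" | "n > length \<Gamma>" by linarith
  then show ?case
  proof cases
    case 3
    \<comment> \<open>Removing \<open>\<sigma>\<close> moves every later entry of the context down
      by one, just as \<open>subst\<close> lowers the index.\<close>
    then have "(\<Gamma> @ \<sigma> # \<Gamma>') ! n = (\<Gamma> @ \<Gamma>') ! (n - 1)"
      by (cases n) (auto simp: nth_append nth_Cons Suc_diff_le split: nat.split)
    moreover have "n - 1 < length (\<Gamma> @ \<Gamma>')" using 3 ty_Bnd by auto
    ultimately show ?thesis using 3 has_type.ty_Bnd[of "n - 1" "\<Gamma> @ \<Gamma>'" \<kappa> \<Sigma>] by simp
  next
    case 1
    then show ?thesis
      using has_type.ty_Bnd[of n "\<Gamma> @ \<Gamma>'" \<kappa> \<Sigma>] by (simp add: nth_append)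
  qed (simp add: * nth_append)
next
  case (ty_Lam \<sigma>' M \<tau>)
  have "closed s" using s by (rule has_type_closed)
  moreover have "has_type \<kappa> \<Sigma> ((\<sigma>' # \<Gamma>) @ \<Gamma>') (subst (length (\<sigma>' # \<Gamma>)) s M) \<tau>"
    by (rule ty_Lam.hyps(2)) simp
  ultimately show ?case by (auto simp: closed_lift intro: has_type.ty_Lam)
qed (auto intro: has_type.intros)

lemma subst_lift: "subst k s (lift k M) = M"
  by (induction M arbitrary: k s) auto

lemma subst_lift_closed:
  "closed s \<Longrightarrow> i \<le> k \<Longrightarrow> subst (Suc k) s (lift i M) = lift i (subst k s M)"
  by (induction M arbitrary: i k) (auto simp: closed_lift)

text \<open>The substitution lemma behind stability of beta steps. Since \<open>s\<close> is closed,
  the lifts it picks up under binders vanish.\<close>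

lemma subst_subst_closed:
  "closed s \<Longrightarrow> i \<le> k \<Longrightarrow>
   subst k s (subst i N M) = subst i (subst k s N) (subst (Suc k) s M)"
  by (induction M arbitrary: i k N) (auto simp: closed_lift closed_subst subst_lift_closed)

lemma step_subst: "step P Q \<Longrightarrow> closed s \<Longrightarrow> step (subst k s P) (subst k s Q)"
proof (induction arbitrary: k rule: step.induct)
  case (step_beta \<tau> M N)
  then show ?case by (simp add: subst_subst_closed closed_lift step.step_beta)
next
  case (step_eta \<tau> M)
  then show ?case by (simp add: subst_lift_closed closed_lift step.step_eta)
qed (auto simp: closed_lift intro: step.intros)

section \<open>Conversion\<close>

lemma conv_typeD:
  assumes "conv \<kappa> \<Sigma> \<tau> M N"
  shows "has_type \<kappa> \<Sigma> [] M \<tau>" "has_type \<kappa> \<Sigma> [] N \<tau>"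
  using assms by (auto simp: conv_def)

lemma conv_refl: "has_type \<kappa> \<Sigma> [] M \<tau> \<Longrightarrow> conv \<kappa> \<Sigma> \<tau> M M"
  by (simp add: conv_def)

lemma conv_sym: "conv \<kappa> \<Sigma> \<tau> M N \<Longrightarrow> conv \<kappa> \<Sigma> \<tau> N M"
  by (auto simp: conv_def intro: equivclp_sym)

lemma conv_trans: "conv \<kappa> \<Sigma> \<tau> M N \<Longrightarrow> conv \<kappa> \<Sigma> \<tau> N P \<Longrightarrow> conv \<kappa> \<Sigma> \<tau> M P"
  by (auto simp: conv_def intro: equivclp_trans)

lemma conv_step:
  "has_type \<kappa> \<Sigma> [] M \<tau> \<Longrightarrow> has_type \<kappa> \<Sigma> [] N \<tau> \<Longrightarrow> step M N \<Longrightarrow> conv \<kappa> \<Sigma> \<tau> M N"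
  by (auto simp: conv_def intro: r_into_equivclp)

lemma equivclp_map:
  assumes "equivclp R x y" and "\<And>x y. R x y \<Longrightarrow> S (f x) (f y)"
  shows "equivclp S (f x) (f y)"
  using assms(1)
proof (induction rule: equivclp_induct)
  case (step y z)
  then have "equivclp S (f y) (f z)"
    using assms(2) by (auto intro: r_into_equivclp equivclp_sym)
  with step.IH show ?case by (rule equivclp_trans)
qed simp

text \<open>The only congruence principle for conversion. Signature and type may change along
  \<open>f\<close>, so it serves application contexts as well as substitution for
  eigenvariables.\<close>

lemma conv_map:
  assumes "conv \<kappa> \<Sigma> \<tau> M N"
    and "\<And>P. has_type \<kappa> \<Sigma> [] P \<tau> \<Longrightarrow> has_type \<kappa> \<Sigma>' [] (f P) \<tau>'"
    and "\<And>P Q. step P Q \<Longrightarrow> step (f P) (f Q)"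
  shows "conv \<kappa> \<Sigma>' \<tau>' (f M) (f N)"
proof -
  have "equivclp (\<lambda>P Q. has_type \<kappa> \<Sigma>' [] P \<tau>' \<and> has_type \<kappa> \<Sigma>' [] Q \<tau>' \<and> step P Q) (f M) (f N)"
    using assms(1) unfolding conv_def
    by (elim conjE equivclp_map[where f = f]) (use assms(2,3) in auto)
  then show ?thesis using assms(1,2) by (auto simp: conv_def)
qed

lemma conv_App:
  assumes M: "conv \<kappa> \<Sigma> (\<sigma> \<rightarrow> \<tau>) M M'" and N: "conv \<kappa> \<Sigma> \<sigma> N N'"
  shows "conv \<kappa> \<Sigma> \<tau> (M \<bullet> N) (M' \<bullet> N')"
proof (rule conv_trans)
  show "conv \<kappa> \<Sigma> \<tau> (M \<bullet> N) (M' \<bullet> N)"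
    by (rule conv_map[OF M]) (use conv_typeD[OF N] in \<open>auto intro: has_type.intros step.intros\<close>)
  show "conv \<kappa> \<Sigma> \<tau> (M' \<bullet> N) (M' \<bullet> N')"
    by (rule conv_map[OF N]) (use conv_typeD[OF M] in \<open>auto intro: has_type.intros step.intros\<close>)
qed

lemma has_type_Const2:
  assumes "\<kappa> c = \<sigma> \<rightarrow> \<rho> \<rightarrow> \<tau>" "has_type \<kappa> \<Sigma> \<Gamma> a \<sigma>" "has_type \<kappa> \<Sigma> \<Gamma> b \<rho>"
  shows "has_type \<kappa> \<Sigma> \<Gamma> (Const c \<bullet> a \<bullet> b) \<tau>"
  using ty_App[OF ty_App assms(3)] ty_Const[of \<kappa> \<Sigma> \<Gamma> c] assms(1,2) by auto

lemma conv_Const2: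
  assumes "\<kappa> c = \<sigma> \<rightarrow> \<rho> \<rightarrow> \<tau>" "conv \<kappa> \<Sigma> \<sigma> a a'" "conv \<kappa> \<Sigma> \<rho> b b'"
  shows "conv \<kappa> \<Sigma> \<tau> (Const c \<bullet> a \<bullet> b) (Const c \<bullet> a' \<bullet> b')"
  using conv_App[OF conv_App assms(3)] conv_refl[OF has_type.ty_Const[of \<kappa> \<Sigma> "[]" c]] assms(1,2)
  by auto

section \<open>Weak head reduction and the logical relation\<close>

inductive whr :: "('c, 'b) trm \<Rightarrow> ('c, 'b) trm \<Rightarrow> bool" where
  whr_beta: "whr (Lam \<tau> M \<bullet> N) (subst 0 N M)"
| whr_App: "whr M M' \<Longrightarrow> whr (M \<bullet> N) (M' \<bullet> N)"

inductive_cases whr_LamE: "whr (Lam \<tau> M) N"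
inductive_cases whr_AppE: "whr (M \<bullet> N) P"

lemma whr_deterministic: "whr M N \<Longrightarrow> whr M N' \<Longrightarrow> N = N'"
proof (induction arbitrary: N' rule: whr.induct)
  case (whr_beta \<tau> M N)
  then show ?case by (auto elim: whr_AppE whr_LamE)
next
  case (whr_App M M' N)
  then show ?case by (blast elim: whr_AppE whr_LamE)
qed

lemma whr_step: "whr M N \<Longrightarrow> step M N"
  by (induction rule: whr.induct) (auto intro: step.intros)

lemma whr_subst: "whr P Q \<Longrightarrow> closed s \<Longrightarrow> whr (subst k s P) (subst k s Q)"
  by (induction arbitrary: k rule: whr.induct)
    (auto simp: subst_subst_closed closed_lift intro: whr.intros)

text \<open>Arguments are compared by conversion and not by the logical relation: this keeps the
  latter a recursion on types, and inversion directly yields convertible arguments. The type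
  \<open>\<sigma>\<close> of the arguments is not recorded.\<close>

inductive neutral_rel ::
  "('c \<Rightarrow> 'b ty) \<Rightarrow> 'b eigsig \<Rightarrow> ('c, 'b) trm \<Rightarrow> ('c, 'b) trm \<Rightarrow> bool"
  for \<kappa> \<Sigma> where
  neutral_Const: "neutral_rel \<kappa> \<Sigma> (Const c) (Const c)"
| neutral_Eig: "neutral_rel \<kappa> \<Sigma> (Eig x) (Eig x)"
| neutral_App: "neutral_rel \<kappa> \<Sigma> M N \<Longrightarrow> conv \<kappa> \<Sigma> \<sigma> a b \<Longrightarrow> neutral_rel \<kappa> \<Sigma> (M \<bullet> a) (N \<bullet> b)"

inductive_cases neutral_AppE: "neutral_rel \<kappa> \<Sigma> (M \<bullet> a) N"
inductive_cases neutral_App2E: "neutral_rel \<kappa> \<Sigma> (M \<bullet> a) (N \<bullet> b)"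
inductive_cases neutral_Const2E: "neutral_rel \<kappa> \<Sigma> (Const c) (Const d)"
inductive_cases neutral_LamE: "neutral_rel \<kappa> \<Sigma> (Lam \<sigma> M) N"

lemma neutral_rel_sym: "neutral_rel \<kappa> \<Sigma> M N \<Longrightarrow> neutral_rel \<kappa> \<Sigma> N M"
  by (induction rule: neutral_rel.induct) (auto intro: neutral_rel.intros conv_sym)

lemma neutral_rel_trans:
  "neutral_rel \<kappa> \<Sigma> M N \<Longrightarrow> neutral_rel \<kappa> \<Sigma> N P \<Longrightarrow> neutral_rel \<kappa> \<Sigma> M P"
proof (induction arbitrary: P rule: neutral_rel.induct)
  case (neutral_App M N \<sigma> a b)
  from neutral_App.prems obtain Q d \<rho> where
    "P = Q \<bullet> d" "neutral_rel \<kappa> \<Sigma> N Q" "conv \<kappa> \<Sigma> \<rho> b d"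
    by (auto elim: neutral_AppE)
  \<comment> \<open>The middle argument \<open>b\<close> is typed at both \<open>\<sigma>\<close>
    and \<open>\<rho>\<close>.\<close>
  moreover from this have "\<rho> = \<sigma>"
    using neutral_App.hyps conv_typeD has_type_unique by metis
  ultimately show ?case
    using neutral_App by (auto intro: neutral_rel.intros conv_trans)
qed

text \<open>A weak head redex has an abstraction at the end of its spine, a neutral term a constant
  or eigenvariable.\<close>

lemma neutral_rel_not_whr: "neutral_rel \<kappa> \<Sigma> M N \<Longrightarrow> \<not> whr M P"
proof (induction arbitrary: P rule: neutral_rel.induct)
  case (neutral_App M N \<sigma> a b)
  then show ?case by (auto elim!: whr_AppE elim: neutral_LamE)
qed (auto elim: whr.cases)

definition head_rel ::
  "('c \<Rightarrow> 'b ty) \<Rightarrow> 'b eigsig \<Rightarrow> ('c, 'b) trm \<Rightarrow> ('c, 'b) trm \<Rightarrow> bool" where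
  "head_rel \<kappa> \<Sigma> M N \<longleftrightarrow> (\<exists>P Q. whr\<^sup>*\<^sup>* M P \<and> whr\<^sup>*\<^sup>* N Q \<and> neutral_rel \<kappa> \<Sigma> P Q)"

text \<open>Weak head reduction is deterministic and stops at neutral terms. Transitivity of
  \<open>head_rel\<close> needs this to match the two neutral forms of its middle term.\<close>

lemma whr_rtranclp_neutral_unique:
  assumes "whr\<^sup>*\<^sup>* M P" "whr\<^sup>*\<^sup>* M Q" "neutral_rel \<kappa> \<Sigma> P P'" "neutral_rel \<kappa> \<Sigma> Q Q'"
  shows "P = Q"
  using assms
proof (induction rule: converse_rtranclp_induct)
  case base
  then show ?case by (metis converse_rtranclpE neutral_rel_not_whr)
next
  case (step M M')
  have "M \<noteq> Q" using step.hyps step.prems neutral_rel_not_whr by blast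
  then obtain N where "whr M N" "whr\<^sup>*\<^sup>* N Q" using step.prems by (metis converse_rtranclpE)
  then show ?case using step whr_deterministic by metis
qed

lemma head_rel_sym: "head_rel \<kappa> \<Sigma> M N \<Longrightarrow> head_rel \<kappa> \<Sigma> N M"
  unfolding head_rel_def using neutral_rel_sym by blast

lemma head_rel_trans:
  assumes "head_rel \<kappa> \<Sigma> M N" "head_rel \<kappa> \<Sigma> N P"
  shows "head_rel \<kappa> \<Sigma> M P"
  using assms unfolding head_rel_def
  by (metis neutral_rel_sym neutral_rel_trans whr_rtranclp_neutral_unique)

text \<open>With conversion included at function types too, related terms are convertible by
  definition, without applying them to a fresh variable; the signature can therefore stay
  fixed.\<close>

primrec log_rel ::
  "('c \<Rightarrow> 'b ty) \<Rightarrow> 'b eigsig \<Rightarrow> 'b ty \<Rightarrow> ('c, 'b) trm \<Rightarrow> ('c, 'b) trm \<Rightarrow> bool" where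
  "log_rel \<kappa> \<Sigma> (Base \<beta>) M N \<longleftrightarrow> conv \<kappa> \<Sigma> (Base \<beta>) M N \<and> head_rel \<kappa> \<Sigma> M N"
| "log_rel \<kappa> \<Sigma> Prop M N \<longleftrightarrow> conv \<kappa> \<Sigma> Prop M N \<and> head_rel \<kappa> \<Sigma> M N"
| "log_rel \<kappa> \<Sigma> (\<sigma> \<rightarrow> \<tau>) M N \<longleftrightarrow>
     conv \<kappa> \<Sigma> (\<sigma> \<rightarrow> \<tau>) M N \<and>
     (\<forall>a b. log_rel \<kappa> \<Sigma> \<sigma> a b \<longrightarrow> log_rel \<kappa> \<Sigma> \<tau> (M \<bullet> a) (N \<bullet> b))"

lemma log_rel_conv: "log_rel \<kappa> \<Sigma> \<tau> M N \<Longrightarrow> conv \<kappa> \<Sigma> \<tau> M N"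
  by (cases \<tau>) auto

lemma log_rel_sym: "log_rel \<kappa> \<Sigma> \<tau> M N \<Longrightarrow> log_rel \<kappa> \<Sigma> \<tau> N M"
  by (induction \<tau> arbitrary: M N) (auto intro: conv_sym head_rel_sym)

lemma log_rel_trans: "log_rel \<kappa> \<Sigma> \<tau> M N \<Longrightarrow> log_rel \<kappa> \<Sigma> \<tau> N P \<Longrightarrow> log_rel \<kappa> \<Sigma> \<tau> M P"
proof (induction \<tau> arbitrary: M N P)
  case (Fn \<sigma> \<tau>)
  have "log_rel \<kappa> \<Sigma> \<tau> (M \<bullet> a) (P \<bullet> b)" if "log_rel \<kappa> \<Sigma> \<sigma> a b" for a b
  proof -
    \<comment> \<open>Partial reflexivity lets the chain run from \<open>M \<bullet> a\<close> over
      \<open>N \<bullet> a\<close> to \<open>P \<bullet> b\<close>.\<close>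
    have "log_rel \<kappa> \<Sigma> \<sigma> a a" using that log_rel_sym Fn.IH(1) by blast
    then show ?thesis using Fn.prems that Fn.IH(2) by (meson log_rel.simps(3))
  qed
  then show ?case using Fn.prems by (auto intro: conv_trans)
qed (auto intro: conv_trans head_rel_trans)

text \<open>Related arguments are convertible, so applying a neutral pair to them gives a neutral
  pair again. This is how constants and eigenvariables enter the relation.\<close>

lemma log_rel_neutral:
  "neutral_rel \<kappa> \<Sigma> M N \<Longrightarrow> conv \<kappa> \<Sigma> \<tau> M N \<Longrightarrow> log_rel \<kappa> \<Sigma> \<tau> M N"
proof (induction \<tau> arbitrary: M N)
  case (Fn \<sigma> \<tau>)
  then show ?case by (meson neutral_App conv_App log_rel_conv log_rel.simps(3))
qed (auto simp: head_rel_def)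

text \<open>Closure under weak head expansion. At function types the redex is carried into the head
  of an application by \<open>whr_App\<close>.\<close>

lemma log_rel_whr:
  "whr M M' \<Longrightarrow> has_type \<kappa> \<Sigma> [] M \<tau> \<Longrightarrow> log_rel \<kappa> \<Sigma> \<tau> M' N \<Longrightarrow> log_rel \<kappa> \<Sigma> \<tau> M N"
proof (induction \<tau> arbitrary: M M' N)
  case (Fn \<sigma> \<tau>)
  have "conv \<kappa> \<Sigma> (\<sigma> \<rightarrow> \<tau>) M N"
    using Fn.prems by (meson conv_step conv_trans conv_typeD(1) log_rel_conv whr_step)
  moreover have "log_rel \<kappa> \<Sigma> \<tau> (M \<bullet> a) (N \<bullet> b)" if "log_rel \<kappa> \<Sigma> \<sigma> a b" for a b
    using Fn.IH(2)[of "M \<bullet> a" "M' \<bullet> a" "N \<bullet> b"] Fn.prems that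
    by (auto intro: whr_App ty_App dest: log_rel_conv conv_typeD)
  ultimately show ?case by simp
qed (auto simp: head_rel_def intro: converse_rtranclp_into_rtranclp conv_step conv_trans
       dest: conv_typeD whr_step)

section \<open>The fundamental lemma\<close>

text \<open>Parametric in \<open>R\<close> because environments are related both by
  \<open>log_rel\<close> and by \<open>conv\<close>.\<close>

inductive env_rel ::
  "('b ty \<Rightarrow> ('c, 'b) trm \<Rightarrow> ('c, 'b) trm \<Rightarrow> bool) \<Rightarrow>
   'b ty list \<Rightarrow> ('c, 'b) trm list \<Rightarrow> ('c, 'b) trm list \<Rightarrow> bool"
  for R where
  env_Nil: "env_rel R [] [] []"
| env_Cons: "R \<sigma> s t \<Longrightarrow> env_rel R \<Gamma> \<gamma> \<delta> \<Longrightarrow> env_rel R (\<sigma> # \<Gamma>) (s # \<gamma>) (t # \<delta>)"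

lemma env_rel_mono:
  "env_rel R \<Gamma> \<gamma> \<delta> \<Longrightarrow> (\<And>\<sigma> s t. R \<sigma> s t \<Longrightarrow> S \<sigma> s t) \<Longrightarrow> env_rel S \<Gamma> \<gamma> \<delta>"
  by (induction rule: env_rel.induct) (auto intro: env_rel.intros)

lemma env_rel_sym:
  "env_rel R \<Gamma> \<gamma> \<delta> \<Longrightarrow> (\<And>\<sigma> s t. R \<sigma> s t \<Longrightarrow> R \<sigma> t s) \<Longrightarrow> env_rel R \<Gamma> \<delta> \<gamma>"
  by (induction rule: env_rel.induct) (auto intro: env_rel.intros)

text \<open>Adequate only for closed \<open>\<gamma>\<close>, since the substitutions are performed one after another.\<close>

primrec close :: "('c, 'b) trm list \<Rightarrow> ('c, 'b) trm \<Rightarrow> ('c, 'b) trm" where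
  "close [] M = M"
| "close (s # \<gamma>) M = close \<gamma> (subst 0 s M)"

lemma close_App: "close \<gamma> (M \<bullet> N) = close \<gamma> M \<bullet> close \<gamma> N"
  by (induction \<gamma> arbitrary: M N) auto

lemma close_Const: "close \<gamma> (Const c) = Const c"
  by (induction \<gamma>) auto

lemma close_Eig: "close \<gamma> (Eig x) = Eig x"
  by (induction \<gamma>) auto

lemma close_closed: "closed M \<Longrightarrow> close \<gamma> M = M"
  by (induction \<gamma>) (auto simp: closed_subst)

lemma env_rel_closed:
  "env_rel (conv \<kappa> \<Sigma>) \<Gamma> \<gamma> \<delta> \<Longrightarrow> \<forall>s\<in>set \<gamma>. closed s"
  by (induction rule: env_rel.induct) (auto dest: conv_typeD has_type_closed)

lemma close_whr: "whr P Q \<Longrightarrow> \<forall>s\<in>set \<gamma>. closed s \<Longrightarrow> whr (close \<gamma> P) (close \<gamma> Q)"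
  by (induction \<gamma> arbitrary: P Q) (auto simp: whr_subst)

lemma close_step: "step P Q \<Longrightarrow> \<forall>s\<in>set \<gamma>. closed s \<Longrightarrow> step (close \<gamma> P) (close \<gamma> Q)"
  by (induction \<gamma> arbitrary: P Q) (auto simp: step_subst)

text \<open>The beta step is made on the open redex and then closed; \<open>a\<close> is closed and
  hence unaffected. Thus \<open>close\<close> is never computed below a binder.\<close>

lemma close_Lam_whr:
  assumes "\<forall>s\<in>set \<gamma>. closed s" "closed a"
  shows "whr (close \<gamma> (Lam \<sigma> M) \<bullet> a) (close (a # \<gamma>) M)"
  using close_whr[OF whr_beta[of \<sigma> M a] assms(1)] assms(2) by (simp add: close_App close_closed)

lemma close_has_type:
  "env_rel (conv \<kappa> \<Sigma>) \<Gamma> \<gamma> \<delta> \<Longrightarrow> has_type \<kappa> \<Sigma> \<Gamma> M \<tau> \<Longrightarrow> has_type \<kappa> \<Sigma> [] (close \<gamma> M) \<tau>"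
proof (induction arbitrary: M rule: env_rel.induct)
  case (env_Cons \<sigma> s t \<Gamma> \<gamma> \<delta>)
  then show ?case using has_type_subst[of \<kappa> \<Sigma> "[]" \<sigma> \<Gamma> M \<tau> s] by (auto dest: conv_typeD)
qed simp

text \<open>
  Conversion in the substituted terms is obtained by abstracting the variable and applying, which
  avoids conversion under binders.
\<close>

lemma conv_close:
  "env_rel (conv \<kappa> \<Sigma>) \<Gamma> \<gamma> \<delta> \<Longrightarrow> has_type \<kappa> \<Sigma> \<Gamma> M \<tau> \<Longrightarrow> conv \<kappa> \<Sigma> \<tau> (close \<gamma> M) (close \<delta> M)"
proof (induction arbitrary: M \<tau> rule: env_rel.induct)
  case env_Nil
  then show ?case by (simp add: conv_refl)
next
  case (env_Cons \<sigma> s t \<Gamma> \<gamma> \<delta>)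
  have env: "env_rel (conv \<kappa> \<Sigma>) (\<sigma> # \<Gamma>) (s # \<gamma>) (t # \<delta>)"
    using env_Cons.hyps by (rule env_rel.env_Cons)
  have env': "env_rel (conv \<kappa> \<Sigma>) (\<sigma> # \<Gamma>) (t # \<delta>) (s # \<gamma>)"
    using env by (rule env_rel_sym) (rule conv_sym)
  have *: "conv \<kappa> \<Sigma> \<tau> (close \<gamma> (Lam \<sigma> M) \<bullet> s) (close \<delta> (Lam \<sigma> M) \<bullet> t)"
    using env_Cons by (auto intro: conv_App ty_Lam)
  have "conv \<kappa> \<Sigma> \<tau> (close \<gamma> (Lam \<sigma> M) \<bullet> s) (close (s # \<gamma>) M)"
    using conv_typeD[OF *] close_has_type[OF env env_Cons.prems] env_rel_closed[OF env]
    by (intro conv_step whr_step close_Lam_whr) auto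
  moreover have "conv \<kappa> \<Sigma> \<tau> (close \<delta> (Lam \<sigma> M) \<bullet> t) (close (t # \<delta>) M)"
    using conv_typeD[OF *] close_has_type[OF env' env_Cons.prems] env_rel_closed[OF env']
    by (intro conv_step whr_step close_Lam_whr) auto
  ultimately show ?case using * by (blast intro: conv_sym conv_trans)
qed

lemma log_rel_close_Bnd:
  "env_rel (log_rel \<kappa> \<Sigma>) \<Gamma> \<gamma> \<delta> \<Longrightarrow> n < length \<Gamma> \<Longrightarrow>
   log_rel \<kappa> \<Sigma> (\<Gamma> ! n) (close \<gamma> (Bnd n)) (close \<delta> (Bnd n))"
proof (induction arbitrary: n rule: env_rel.induct)
  case (env_Cons \<sigma> s t \<Gamma> \<gamma> \<delta>)
  have "closed s" "closed t"
    using env_Cons.hyps(1) by (meson log_rel_conv conv_typeD has_type_closed)+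
  then show ?case using env_Cons by (cases n) (auto simp: close_closed)
qed simp

text \<open>Both applied abstractions expand weakly from their bodies. The bodies may differ, so
  this covers reflexivity as well as a step below an abstraction.\<close>

lemma log_rel_close_Lam:
  assumes env: "env_rel (log_rel \<kappa> \<Sigma>) \<Gamma> \<gamma> \<delta>"
    and conv: "conv \<kappa> \<Sigma> (\<sigma> \<rightarrow> \<tau>) (close \<gamma> (Lam \<sigma> M)) (close \<delta> (Lam \<sigma> N))"
    and body: "\<And>a b. log_rel \<kappa> \<Sigma> \<sigma> a b \<Longrightarrow>
      log_rel \<kappa> \<Sigma> \<tau> (close (a # \<gamma>) M) (close (b # \<delta>) N)"
  shows "log_rel \<kappa> \<Sigma> (\<sigma> \<rightarrow> \<tau>) (close \<gamma> (Lam \<sigma> M)) (close \<delta> (Lam \<sigma> N))"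
proof -
  have env': "env_rel (conv \<kappa> \<Sigma>) \<Gamma> \<gamma> \<delta>" using env by (rule env_rel_mono) (rule log_rel_conv)
  have closed: "\<forall>s\<in>set \<gamma>. closed s" "\<forall>s\<in>set \<delta>. closed s"
    using env_rel_closed[OF env'] env_rel_closed[OF env_rel_sym[OF env' conv_sym]] by auto
  have "log_rel \<kappa> \<Sigma> \<tau> (close \<gamma> (Lam \<sigma> M) \<bullet> a) (close \<delta> (Lam \<sigma> N) \<bullet> b)"
    if ab: "log_rel \<kappa> \<Sigma> \<sigma> a b" for a b
  proof -
    note tab = conv_typeD[OF log_rel_conv[OF ab]]
    have 1: "log_rel \<kappa> \<Sigma> \<tau> (close \<gamma> (Lam \<sigma> M) \<bullet> a) (close (b # \<delta>) N)"
      by (rule log_rel_whr[OF close_Lam_whr[OF closed(1) has_type_closed[OF tab(1)]] _ body[OF ab]])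
        (rule ty_App[OF conv_typeD(1)[OF conv] tab(1)])
    show ?thesis
      \<comment> \<open>Expansion acts on the left only; symmetry carries it to the right-hand
        side.\<close>
      by (rule log_rel_sym,
          rule log_rel_whr[OF close_Lam_whr[OF closed(2) has_type_closed[OF tab(2)]] _ log_rel_sym[OF 1]])
        (rule ty_App[OF conv_typeD(2)[OF conv] tab(2)])
  qed
  then show ?thesis using conv by simp
qed

text \<open>Reflexivity of well-typed terms under related environments, by induction on typing:
  atoms are neutral, application is built into \<open>log_rel\<close>, abstraction uses weak head
  expansion.\<close>

lemma log_rel_close:
  "has_type \<kappa> \<Sigma> \<Gamma> M \<tau> \<Longrightarrow> env_rel (log_rel \<kappa> \<Sigma>) \<Gamma> \<gamma> \<delta> \<Longrightarrow>
   log_rel \<kappa> \<Sigma> \<tau> (close \<gamma> M) (close \<delta> M)"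
proof (induction arbitrary: \<gamma> \<delta> rule: has_type.induct)
  case (ty_Const \<Gamma> c)
  then show ?case
    by (auto simp: close_Const intro!: log_rel_neutral neutral_Const conv_refl has_type.ty_Const)
next
  case (ty_Eig x \<tau> \<Gamma>)
  then show ?case
    by (auto simp: close_Eig intro!: log_rel_neutral neutral_Eig conv_refl has_type.ty_Eig)
next
  case (ty_Bnd n \<Gamma>)
  then show ?case by (simp add: log_rel_close_Bnd)
next
  case (ty_App \<Gamma> M \<sigma> \<tau> N)
  then show ?case by (fastforce simp: close_App)
next
  case (ty_Lam \<sigma> \<Gamma> M \<tau>)
  have "env_rel (conv \<kappa> \<Sigma>) \<Gamma> \<gamma> \<delta>"
    using ty_Lam.prems by (rule env_rel_mono) (rule log_rel_conv)
  then show ?case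
    using ty_Lam.hyps ty_Lam.prems
    by (intro log_rel_close_Lam conv_close has_type.ty_Lam ty_Lam.IH env_Cons)
qed

text \<open>Steps are treated on open terms under two related environments, which is what the
  induction needs in order to go below an abstraction.\<close>

lemma log_rel_close_step:
  "step P Q \<Longrightarrow> has_type \<kappa> \<Sigma> \<Gamma> P \<tau> \<Longrightarrow> has_type \<kappa> \<Sigma> \<Gamma> Q \<tau> \<Longrightarrow>
   env_rel (log_rel \<kappa> \<Sigma>) \<Gamma> \<gamma> \<delta> \<Longrightarrow> log_rel \<kappa> \<Sigma> \<tau> (close \<gamma> P) (close \<delta> Q)"
proof (induction arbitrary: \<Gamma> \<tau> \<gamma> \<delta> rule: step.induct)
  case (step_beta \<sigma> M N)
  have env: "env_rel (conv \<kappa> \<Sigma>) \<Gamma> \<gamma> \<delta>"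
    using step_beta.prems(3) by (rule env_rel_mono) (rule log_rel_conv)
  show ?case
    \<comment> \<open>A beta step at the root remains a weak head step after closing, so reflexivity
      of the reduct suffices.\<close>
    by (rule log_rel_whr[OF close_whr[OF whr_beta env_rel_closed[OF env]]
          close_has_type[OF env step_beta.prems(1)]])
      (rule log_rel_close[OF step_beta.prems(2,3)])
next
  case (step_eta \<sigma> M)
  have env: "env_rel (conv \<kappa> \<Sigma>) \<Gamma> \<gamma> \<delta>"
    using step_eta.prems(3) by (rule env_rel_mono) (rule log_rel_conv)
  let ?P = "Lam \<sigma> (lift 0 M \<bullet> Bnd 0)"
  obtain \<rho> where \<tau>: "\<tau> = \<sigma> \<rightarrow> \<rho>" using step_eta.prems(1) by (auto elim: has_type_LamE)
  have M: "log_rel \<kappa> \<Sigma> \<tau> (close \<gamma> M) (close \<delta> M)"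
    using step_eta.prems log_rel_close by blast
  have P: "has_type \<kappa> \<Sigma> [] (close \<gamma> ?P) \<tau>" using close_has_type[OF env step_eta.prems(1)] .
  have "conv \<kappa> \<Sigma> \<tau> (close \<gamma> ?P) (close \<gamma> M)"
    using P close_has_type[OF env step_eta.prems(2)] close_step[OF step.step_eta env_rel_closed[OF env]]
    by (rule conv_step)
  then have "conv \<kappa> \<Sigma> \<tau> (close \<gamma> ?P) (close \<delta> M)"
    using conv_trans log_rel_conv[OF M] by blast
  moreover have "log_rel \<kappa> \<Sigma> \<rho> (close \<gamma> ?P \<bullet> a) (close \<delta> M \<bullet> b)" if ab: "log_rel \<kappa> \<Sigma> \<sigma> a b" for a b
  proof -
    have a: "has_type \<kappa> \<Sigma> [] a \<sigma>" "closed a"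
      using ab by (auto dest: log_rel_conv conv_typeD has_type_closed)
    \<comment> \<open>Applied to \<open>a\<close>, the eta-expansion contracts to \<open>M\<close>
      applied to \<open>a\<close>: the substitution cancels the lift.\<close>
    have "whr (close \<gamma> ?P \<bullet> a) (close \<gamma> M \<bullet> a)"
      using close_Lam_whr[OF env_rel_closed[OF env] a(2), of \<sigma> "lift 0 M \<bullet> Bnd 0"] a(2)
      by (simp add: close_App subst_lift close_closed)
    moreover have "has_type \<kappa> \<Sigma> [] (close \<gamma> ?P \<bullet> a) \<rho>" using P a \<tau> by (auto intro: ty_App)
    ultimately show ?thesis using M ab \<tau> log_rel_whr by fastforce
  qed
  ultimately show ?case by (simp add: \<tau>)
next
  case (step_AppL M M' N)
  obtain \<sigma> \<sigma>' where t: "has_type \<kappa> \<Sigma> \<Gamma> M (\<sigma> \<rightarrow> \<tau>)" "has_type \<kappa> \<Sigma> \<Gamma> N \<sigma>"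
    "has_type \<kappa> \<Sigma> \<Gamma> M' (\<sigma>' \<rightarrow> \<tau>)" "has_type \<kappa> \<Sigma> \<Gamma> N \<sigma>'"
    using step_AppL.prems by (meson has_type_AppE)
  then have "\<sigma>' = \<sigma>" using has_type_unique by blast
  then show ?case
    using step_AppL.IH[OF t(1) _ step_AppL.prems(3)] t log_rel_close[OF t(2) step_AppL.prems(3)]
    by (simp add: close_App)
next
  case (step_AppR N N' M)
  obtain \<sigma> \<sigma>' where t: "has_type \<kappa> \<Sigma> \<Gamma> M (\<sigma> \<rightarrow> \<tau>)" "has_type \<kappa> \<Sigma> \<Gamma> N \<sigma>"
    "has_type \<kappa> \<Sigma> \<Gamma> M (\<sigma>' \<rightarrow> \<tau>)" "has_type \<kappa> \<Sigma> \<Gamma> N' \<sigma>'"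
    using step_AppR.prems by (meson has_type_AppE)
  then have "\<sigma>' = \<sigma>" using has_type_unique by blast
  then show ?case
    using step_AppR.IH[OF t(2) _ step_AppR.prems(3)] t log_rel_close[OF t(1) step_AppR.prems(3)]
    by (simp add: close_App)
next
  case (step_Lam M M' \<sigma>)
  have env: "env_rel (conv \<kappa> \<Sigma>) \<Gamma> \<gamma> \<delta>"
    using step_Lam.prems(3) by (rule env_rel_mono) (rule log_rel_conv)
  obtain \<rho> where \<tau>: "\<tau> = \<sigma> \<rightarrow> \<rho>" and
    t: "has_type \<kappa> \<Sigma> (\<sigma> # \<Gamma>) M \<rho>" "has_type \<kappa> \<Sigma> (\<sigma> # \<Gamma>) M' \<rho>"
    using step_Lam.prems by (auto elim!: has_type_LamE)
  have "conv \<kappa> \<Sigma> \<tau> (close \<gamma> (Lam \<sigma> M)) (close \<gamma> (Lam \<sigma> M'))"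
    using close_has_type[OF env step_Lam.prems(1)] close_has_type[OF env step_Lam.prems(2)]
      close_step[OF step.step_Lam[OF step_Lam.hyps] env_rel_closed[OF env]]
    by (rule conv_step)
  then have "conv \<kappa> \<Sigma> \<tau> (close \<gamma> (Lam \<sigma> M)) (close \<delta> (Lam \<sigma> M'))"
    using conv_trans conv_close[OF env step_Lam.prems(2)] by blast
  then show ?case
    unfolding \<tau> using step_Lam.prems(3)
    by (intro log_rel_close_Lam step_Lam.IH[OF t] env_Cons)
qed

section \<open>From conversion to injectivity and distinctness of constants\<close>

lemma conv_log_rel:
  assumes "conv \<kappa> \<Sigma> \<tau> M N"
  shows "log_rel \<kappa> \<Sigma> \<tau> M N"
proof -
  have "equivclp (\<lambda>P Q. has_type \<kappa> \<Sigma> [] P \<tau> \<and> has_type \<kappa> \<Sigma> [] Q \<tau> \<and> step P Q) M N"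
    using assms by (simp add: conv_def)
  then show ?thesis
  proof (induction rule: equivclp_induct)
    case base
    then show ?case
      using log_rel_close[OF conv_typeD(1)[OF assms] env_Nil] by simp
  next
    case (step P Q)
    \<comment> \<open>A link of the conversion chain may run in either direction.\<close>
    then have "log_rel \<kappa> \<Sigma> \<tau> P Q"
      using log_rel_close_step[OF _ _ _ env_Nil, of _ _ \<kappa> \<Sigma> \<tau>] log_rel_sym by fastforce
    with step.IH show ?case by (rule log_rel_trans)
  qed
qed

text \<open>At a base type or \<open>Prop\<close> the logical relation exposes weak head forms. Both
  terms are already in that form, so inverting \<open>neutral_rel\<close> compares heads and
  arguments.\<close>

lemma conv_Const2_inject:
  assumes conv: "conv \<kappa> \<Sigma> \<tau> (Const c \<bullet> a \<bullet> b) (Const d \<bullet> a' \<bullet> b')"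
    and c: "\<kappa> c = \<sigma> \<rightarrow> \<rho> \<rightarrow> \<tau>" and \<tau>: "\<tau> = Prop \<or> (\<exists>\<beta>. \<tau> = Base \<beta>)"
  shows "c = d" "conv \<kappa> \<Sigma> \<sigma> a a'" "conv \<kappa> \<Sigma> \<rho> b b'"
proof -
  have ty: "has_type \<kappa> \<Sigma> [] a \<sigma>" "has_type \<kappa> \<Sigma> [] b \<rho>"
    using conv_typeD(1)[OF conv] c by (auto elim!: has_type_AppE has_type_ConstE)
  have whnf: "P = Const e \<bullet> u \<bullet> v" if "whr\<^sup>*\<^sup>* (Const e \<bullet> u \<bullet> v) P" for e u v and P :: "('a, 'b) trm"
    using that by (cases rule: converse_rtranclpE) (auto elim!: whr_AppE elim: whr.cases)
  have "head_rel \<kappa> \<Sigma> (Const c \<bullet> a \<bullet> b) (Const d \<bullet> a' \<bullet> b')"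
    using conv_log_rel[OF conv] \<tau> by auto
  then have "neutral_rel \<kappa> \<Sigma> (Const c \<bullet> a \<bullet> b) (Const d \<bullet> a' \<bullet> b')"
    unfolding head_rel_def by (auto dest!: whnf)
  \<comment> \<open>The hidden types \<open>\<sigma>'\<close> and \<open>\<rho>'\<close> are forced
    to be the argument types of \<open>c\<close> by uniqueness of typing.\<close>
  then obtain \<sigma>' \<rho>' where "c = d" "conv \<kappa> \<Sigma> \<sigma>' a a'" "conv \<kappa> \<Sigma> \<rho>' b b'"
    by (auto elim!: neutral_App2E neutral_Const2E)
  then show "c = d" "conv \<kappa> \<Sigma> \<sigma> a a'" "conv \<kappa> \<Sigma> \<rho> b b'"
    using ty conv_typeD(1) has_type_unique by metis+
qed


section \<open>Substitution for eigenvariables\<close>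

text \<open>The images are not lifted below \<open>Lam\<close>; this is correct for closed images,
  the only ones used with binders below.\<close>

primrec eig_subst :: "(nat \<Rightarrow> ('c, 'b) trm) \<Rightarrow> ('c, 'b) trm \<Rightarrow> ('c, 'b) trm" where
  "eig_subst \<theta> (Const c) = Const c"
| "eig_subst \<theta> (Eig x) = \<theta> x"
| "eig_subst \<theta> (Bnd n) = Bnd n"
| "eig_subst \<theta> (M \<bullet> N) = eig_subst \<theta> M \<bullet> eig_subst \<theta> N"
| "eig_subst \<theta> (Lam \<tau> M) = Lam \<tau> (eig_subst \<theta> M)"

primrec eig_subst_gform :: "(nat \<Rightarrow> ('c, 'b) trm) \<Rightarrow> ('c, 'b) gform \<Rightarrow> ('c, 'b) gform" where
  "eig_subst_gform \<theta> Top = Top"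
| "eig_subst_gform \<theta> (Atom A) = Atom (eig_subst \<theta> A)"
| "eig_subst_gform \<theta> (Imp A G) = Imp (eig_subst \<theta> A) (eig_subst_gform \<theta> G)"
| "eig_subst_gform \<theta> (All \<tau> G) = All \<tau> (eig_subst_gform \<theta> G)"
| "eig_subst_gform \<theta> (Ex \<tau> G) = Ex \<tau> (eig_subst_gform \<theta> G)"
| "eig_subst_gform \<theta> (And G H) = And (eig_subst_gform \<theta> G) (eig_subst_gform \<theta> H)"
| "eig_subst_gform \<theta> (Or G H) = Or (eig_subst_gform \<theta> G) (eig_subst_gform \<theta> H)"

primrec eig_subst_clause :: "(nat \<Rightarrow> ('c, 'b) trm) \<Rightarrow> ('c, 'b) clause \<Rightarrow> ('c, 'b) clause" where
  "eig_subst_clause \<theta> (CAtom A) = CAtom (eig_subst \<theta> A)"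
| "eig_subst_clause \<theta> (CImp G D) = CImp (eig_subst_gform \<theta> G) (eig_subst_clause \<theta> D)"
| "eig_subst_clause \<theta> (CAll \<tau> D) = CAll \<tau> (eig_subst_clause \<theta> D)"

text \<open>Sequents carry no well-formedness condition, so \<open>c \<notin> dom \<Sigma>\<close>
  alone does not make \<open>c\<close> fresh for the formulas. Inclusion of their eigenvariables in
  \<open>dom \<Sigma>\<close> does.\<close>

primrec eigs :: "('c, 'b) trm \<Rightarrow> nat set" where
  "eigs (Const c) = {}"
| "eigs (Eig x) = {x}"
| "eigs (Bnd n) = {}"
| "eigs (M \<bullet> N) = eigs M \<union> eigs N"
| "eigs (Lam \<tau> M) = eigs M"

primrec eigs_gform :: "('c, 'b) gform \<Rightarrow> nat set" where
  "eigs_gform Top = {}"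
| "eigs_gform (Atom A) = eigs A"
| "eigs_gform (Imp A G) = eigs A \<union> eigs_gform G"
| "eigs_gform (All \<tau> G) = eigs_gform G"
| "eigs_gform (Ex \<tau> G) = eigs_gform G"
| "eigs_gform (And G H) = eigs_gform G \<union> eigs_gform H"
| "eigs_gform (Or G H) = eigs_gform G \<union> eigs_gform H"

primrec eigs_clause :: "('c, 'b) clause \<Rightarrow> nat set" where
  "eigs_clause (CAtom A) = eigs A"
| "eigs_clause (CImp G D) = eigs_gform G \<union> eigs_clause D"
| "eigs_clause (CAll \<tau> D) = eigs_clause D"

lemma eigs_lift: "eigs (lift k M) = eigs M"
  by (induction M arbitrary: k) auto

lemma eigs_subst: "eigs (subst k s M) \<subseteq> eigs s \<union> eigs M"
proof (induction M arbitrary: k s)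
  case (Lam \<tau> M)
  then show ?case using eigs_lift by fastforce
next
  case (App M N)
  show ?case using App.IH(1)[of k s] App.IH(2)[of k s] by auto
qed auto

lemma eigs_subst_gform: "eigs_gform (subst_gform k s G) \<subseteq> eigs s \<union> eigs_gform G"
proof (induction G arbitrary: k s)
  case (All \<tau> G)
  then show ?case using eigs_lift by fastforce
next
  case (Ex \<tau> G)
  then show ?case using eigs_lift by fastforce
qed (use eigs_subst in \<open>fastforce+\<close>)

lemma eigs_subst_clause: "eigs_clause (subst_clause k s D) \<subseteq> eigs s \<union> eigs_clause D"
proof (induction D arbitrary: k s)
  case (CAtom A)
  then show ?case using eigs_subst by fastforce
next
  case (CImp G D)
  then show ?case using eigs_subst_gform by fastforce
next
  case (CAll \<tau> D)
  then show ?case using eigs_lift by fastforce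
qed

lemma has_type_eigs: "has_type \<kappa> \<Sigma> \<Gamma> M \<tau> \<Longrightarrow> eigs M \<subseteq> dom \<Sigma>"
  by (induction rule: has_type.induct) auto

lemma clause_inst_eigs:
  "clause_inst \<kappa> \<Sigma> D Gs A \<Longrightarrow> eigs_clause D \<subseteq> dom \<Sigma> \<Longrightarrow> \<forall>G\<in>set Gs. eigs_gform G \<subseteq> dom \<Sigma>"
proof (induction rule: clause_inst.induct)
  case (inst_All t \<tau> D Gs A)
  have "eigs_clause (subst_clause 0 t D) \<subseteq> dom \<Sigma>"
    using eigs_subst_clause[of 0 t D] has_type_eigs[OF inst_All.hyps(1)] inst_All.prems by auto
  then show ?case by (rule inst_All.IH)
qed auto

lemma eig_subst_cong: "(\<And>x. x \<in> eigs M \<Longrightarrow> \<theta> x = \<theta>' x) \<Longrightarrow> eig_subst \<theta> M = eig_subst \<theta>' M"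
  by (induction M) auto

lemma eig_subst_gform_cong:
  "(\<And>x. x \<in> eigs_gform G \<Longrightarrow> \<theta> x = \<theta>' x) \<Longrightarrow> eig_subst_gform \<theta> G = eig_subst_gform \<theta>' G"
  by (induction G) (auto intro: eig_subst_cong)

lemma eig_subst_clause_cong:
  "(\<And>x. x \<in> eigs_clause D \<Longrightarrow> \<theta> x = \<theta>' x) \<Longrightarrow> eig_subst_clause \<theta> D = eig_subst_clause \<theta>' D"
  by (induction D) (auto intro: eig_subst_cong eig_subst_gform_cong)

lemma eig_subst_Eig: "eig_subst Eig M = M"
  by (induction M) auto

lemma eig_subst_gform_Eig: "eig_subst_gform Eig G = G"
  by (induction G) (auto simp: eig_subst_Eig)

lemma eig_subst_clause_Eig: "eig_subst_clause Eig D = D"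
  by (induction D) (auto simp: eig_subst_Eig eig_subst_gform_Eig)

context
  fixes \<theta> :: "nat \<Rightarrow> ('c, 'b) trm"
  assumes closed: "\<And>x. closed (\<theta> x)"
begin

lemma eig_subst_lift: "eig_subst \<theta> (lift k M) = lift k (eig_subst \<theta> M)"
  by (induction M arbitrary: k) (auto simp: closed_lift[OF closed])

lemma eig_subst_subst: "eig_subst \<theta> (subst k s M) = subst k (eig_subst \<theta> s) (eig_subst \<theta> M)"
  by (induction M arbitrary: k s) (auto simp: closed_subst[OF closed] eig_subst_lift)

lemma eig_subst_subst_gform:
  "eig_subst_gform \<theta> (subst_gform k s G) = subst_gform k (eig_subst \<theta> s) (eig_subst_gform \<theta> G)"
  by (induction G arbitrary: k s) (auto simp: eig_subst_subst eig_subst_lift)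

lemma eig_subst_subst_clause:
  "eig_subst_clause \<theta> (subst_clause k s D) = subst_clause k (eig_subst \<theta> s) (eig_subst_clause \<theta> D)"
  by (induction D arbitrary: k s) (auto simp: eig_subst_subst eig_subst_subst_gform eig_subst_lift)

lemma step_eig_subst: "step P Q \<Longrightarrow> step (eig_subst \<theta> P) (eig_subst \<theta> Q)"
  by (induction rule: step.induct) (auto simp: eig_subst_subst eig_subst_lift intro: step.intros)

end

lemma has_type_eig_subst:
  assumes "has_type \<kappa> \<Sigma> \<Gamma> M \<tau>" and "\<And>x \<tau>. \<Sigma> x = Some \<tau> \<Longrightarrow> has_type \<kappa> \<Sigma>' [] (\<theta> x) \<tau>"
  shows "has_type \<kappa> \<Sigma>' \<Gamma> (eig_subst \<theta> M) \<tau>"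
  using assms(1)
proof (induction rule: has_type.induct)
  case (ty_Eig x \<tau> \<Gamma>)
  then show ?case using has_type_append[OF assms(2), of x \<tau> \<Gamma>] by simp
qed (auto intro: has_type.intros)

text \<open>Weakening is substitution by the identity \<open>Eig\<close> into a larger
  signature.\<close>

lemma has_type_map_le:
  assumes "has_type \<kappa> \<Sigma> \<Gamma> M \<tau>" and "\<Sigma> \<subseteq>\<^sub>m \<Sigma>'"
  shows "has_type \<kappa> \<Sigma>' \<Gamma> M \<tau>"
proof -
  have "\<Sigma>' x = Some \<sigma>" if "\<Sigma> x = Some \<sigma>" for x \<sigma>
    using assms(2) that by (metis domI map_le_def)
  then show ?thesis
    using has_type_eig_subst[OF assms(1), of \<Sigma>' Eig] by (auto simp: eig_subst_Eig intro: ty_Eig)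
qed

lemma conv_eig_subst:
  assumes "conv \<kappa> \<Sigma> \<tau> M N" and "\<And>x. closed (\<theta> x)"
    and "\<And>x \<tau>. \<Sigma> x = Some \<tau> \<Longrightarrow> has_type \<kappa> \<Sigma>' [] (\<theta> x) \<tau>"
  shows "conv \<kappa> \<Sigma>' \<tau> (eig_subst \<theta> M) (eig_subst \<theta> N)"
  using assms(1) by (rule conv_map) (use assms(2,3) has_type_eig_subst step_eig_subst in blast)+

lemma clause_inst_eig_subst:
  assumes "clause_inst \<kappa> \<Sigma> D Gs A" and "\<And>x. closed (\<theta> x)"
    and "\<And>x \<tau>. \<Sigma> x = Some \<tau> \<Longrightarrow> has_type \<kappa> \<Sigma>' [] (\<theta> x) \<tau>"
  shows "clause_inst \<kappa> \<Sigma>' (eig_subst_clause \<theta> D) (map (eig_subst_gform \<theta>) Gs) (eig_subst \<theta> A)"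
  using assms(1)
proof (induction rule: clause_inst.induct)
  case (inst_All t \<tau> D Gs A)
  have "has_type \<kappa> \<Sigma>' [] (eig_subst \<theta> t) \<tau>"
    using inst_All.hyps(1) assms(3) by (rule has_type_eig_subst)
  then show ?case
    using inst_All.IH assms(2) by (auto simp: eig_subst_subst_clause intro: clause_inst.inst_All)
qed (auto intro: clause_inst.intros)

section \<open>Structural properties of derivations\<close>

text \<open>Every rule is stable under a typed substitution. Quantifying over
  \<open>\<theta>\<close> and \<open>\<Sigma>'\<close> in the induction allows the eigenvariable of
  GENERIC to be renamed.\<close>

lemma hh_eig_subst:
  assumes "hh \<kappa> \<Sigma> \<Delta> G" and "eigs_gform G \<subseteq> dom \<Sigma>" and "\<forall>D\<in>set \<Delta>. eigs_clause D \<subseteq> dom \<Sigma>"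
    and "finite (dom \<Sigma>')" and "\<And>x. closed (\<theta> x)"
    and "\<And>x \<tau>. \<Sigma> x = Some \<tau> \<Longrightarrow> has_type \<kappa> \<Sigma>' [] (\<theta> x) \<tau>"
  shows "hh \<kappa> \<Sigma>' (map (eig_subst_clause \<theta>) \<Delta>) (eig_subst_gform \<theta> G)"
  using assms
proof (induction arbitrary: \<Sigma>' \<theta> rule: hh.induct)
  case (INSTANCE \<Sigma> t \<tau> \<Delta> G)
  have "eigs_gform (subst_gform 0 t G) \<subseteq> dom \<Sigma>"
    using eigs_subst_gform[of 0 t G] has_type_eigs[OF INSTANCE.hyps(1)] INSTANCE.prems(1) by auto
  then have "hh \<kappa> \<Sigma>' (map (eig_subst_clause \<theta>) \<Delta>) (eig_subst_gform \<theta> (subst_gform 0 t G))"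
    using INSTANCE.IH INSTANCE.prems by blast
  moreover have "has_type \<kappa> \<Sigma>' [] (eig_subst \<theta> t) \<tau>"
    using INSTANCE.hyps(1) INSTANCE.prems(5) by (rule has_type_eig_subst)
  ultimately show ?case
    using INSTANCE.prems(4) by (auto simp: eig_subst_subst_gform intro: hh.INSTANCE)
next
  case (AUGMENT \<Sigma> A \<Delta> G)
  then have "hh \<kappa> \<Sigma>' (map (eig_subst_clause \<theta>) (CAtom A # \<Delta>)) (eig_subst_gform \<theta> G)"
    by (intro AUGMENT.IH) auto
  then show ?case by (auto intro: hh.AUGMENT)
next
  case (GENERIC c \<Sigma> \<tau> \<Delta> G)
  \<comment> \<open>The name \<open>c\<close> may already be taken in \<open>\<Sigma>'\<close>;
    finiteness supplies a fresh one.\<close>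
  obtain d where d: "d \<notin> dom \<Sigma>'"
    using GENERIC.prems(3) ex_new_if_finite infinite_UNIV_nat by blast
  let ?\<theta> = "\<theta>(c := Eig d)" and ?\<Sigma> = "\<Sigma>'(d \<mapsto> \<tau>)"
  have closed: "closed (?\<theta> x)" for x using GENERIC.prems(4) by (simp add: closed_Eig)
  have le: "\<Sigma>' \<subseteq>\<^sub>m ?\<Sigma>" using d by (auto simp: map_le_def)
  have ty: "has_type \<kappa> ?\<Sigma> [] (?\<theta> x) \<rho>" if "(\<Sigma>(c \<mapsto> \<tau>)) x = Some \<rho>" for x \<rho>
    using that has_type_map_le[OF GENERIC.prems(5) le] by (auto intro: ty_Eig split: if_splits)
  have G: "eigs_gform (subst_gform 0 (Eig c) G) \<subseteq> dom (\<Sigma>(c \<mapsto> \<tau>))"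
    using eigs_subst_gform[of 0 "Eig c" G] GENERIC.prems(1) by auto
  have \<Delta>: "\<forall>D\<in>set \<Delta>. eigs_clause D \<subseteq> dom (\<Sigma>(c \<mapsto> \<tau>))"
    using GENERIC.prems(2) by auto
  have fin: "finite (dom ?\<Sigma>)" using GENERIC.prems(3) by simp
  have "hh \<kappa> ?\<Sigma> (map (eig_subst_clause ?\<theta>) \<Delta>)
      (eig_subst_gform ?\<theta> (subst_gform 0 (Eig c) G))"
    using G \<Delta> fin closed ty by (rule GENERIC.IH)
  \<comment> \<open>By well-formedness \<open>c\<close> occurs neither in \<open>\<Delta>\<close>
    nor in \<open>G\<close>, so the update of \<open>\<theta>\<close> is invisible there.\<close>
  moreover have "map (eig_subst_clause ?\<theta>) \<Delta> = map (eig_subst_clause \<theta>) \<Delta>"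
    using GENERIC.hyps(1) GENERIC.prems(2) by (intro map_cong refl eig_subst_clause_cong) auto
  moreover have "eig_subst_gform ?\<theta> G = eig_subst_gform \<theta> G"
    using GENERIC.hyps(1) GENERIC.prems(1) by (intro eig_subst_gform_cong) auto
  ultimately show ?case
    using hh.GENERIC[OF d, of \<kappa> \<tau>] eig_subst_subst_gform[of ?\<theta> 0 "Eig c" G, OF closed] by simp
next
  case (BACKCHAIN D \<Delta> \<Sigma> Gs A' A)
  have "\<forall>G\<in>set Gs. eigs_gform G \<subseteq> dom \<Sigma>"
    using clause_inst_eigs[OF BACKCHAIN.hyps(2)] BACKCHAIN.hyps(1) BACKCHAIN.prems(2) by blast
  then have "\<forall>G\<in>set (map (eig_subst_gform \<theta>) Gs). hh \<kappa> \<Sigma>' (map (eig_subst_clause \<theta>) \<Delta>) G"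
    using BACKCHAIN.IH BACKCHAIN.prems by auto
  moreover have "eig_subst_clause \<theta> D \<in> set (map (eig_subst_clause \<theta>) \<Delta>)"
    using BACKCHAIN.hyps(1) by simp
  moreover have "clause_inst \<kappa> \<Sigma>' (eig_subst_clause \<theta> D) (map (eig_subst_gform \<theta>) Gs)
      (eig_subst \<theta> A')"
    using BACKCHAIN.hyps(2) BACKCHAIN.prems(4,5) by (rule clause_inst_eig_subst)
  moreover have "conv \<kappa> \<Sigma>' Prop (eig_subst \<theta> A') (eig_subst \<theta> A)"
    using BACKCHAIN.hyps(3) BACKCHAIN.prems(4,5) by (rule conv_eig_subst)
  ultimately have "hh \<kappa> \<Sigma>' (map (eig_subst_clause \<theta>) \<Delta>) (Atom (eig_subst \<theta> A))"
    by (blast intro: hh.BACKCHAIN)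
  then show ?case by simp
qed (auto intro: hh.intros)

lemma hh_weaken_sig:
  assumes "hh \<kappa> \<Sigma> \<Delta> G" and "eigs_gform G \<subseteq> dom \<Sigma>" and "\<forall>D\<in>set \<Delta>. eigs_clause D \<subseteq> dom \<Sigma>"
    and "finite (dom \<Sigma>')" and "\<Sigma> \<subseteq>\<^sub>m \<Sigma>'"
  shows "hh \<kappa> \<Sigma>' \<Delta> G"
proof -
  have "has_type \<kappa> \<Sigma>' [] (Eig x) \<tau>" if "\<Sigma> x = Some \<tau>" for x \<tau>
    using has_type_map_le[OF ty_Eig[of \<Sigma>, OF that] assms(5)] .
  then have "hh \<kappa> \<Sigma>' (map (eig_subst_clause Eig) \<Delta>) (eig_subst_gform Eig G)"
    by (rule hh_eig_subst[OF assms(1-4) closed_Eig])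
  moreover have "eig_subst_clause Eig = (\<lambda>D :: ('a, 'b) clause. D)"
    by (rule ext) (rule eig_subst_clause_Eig)
  ultimately show ?thesis by (simp add: eig_subst_gform_Eig)
qed

lemma hh_weaken: "hh \<kappa> \<Sigma> \<Delta> G \<Longrightarrow> set \<Delta> \<subseteq> set \<Delta>' \<Longrightarrow> hh \<kappa> \<Sigma> \<Delta>' G"
proof (induction arbitrary: \<Delta>' rule: hh.induct)
  case (AUGMENT \<Sigma> A \<Delta> G)
  then have "hh \<kappa> \<Sigma> (CAtom A # \<Delta>') G" by (intro AUGMENT.IH) auto
  then show ?case by (rule hh.AUGMENT)
next
  case (BACKCHAIN D \<Delta> \<Sigma> Gs A' A)
  then show ?case by (intro hh.BACKCHAIN[of D \<Delta>' \<kappa> \<Sigma> Gs A' A]) auto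
qed (auto intro: hh.intros)

text \<open>An atom is derived only by BACKCHAIN, whose conversion premise absorbs one more
  conversion.\<close>

lemma hh_Atom_conv:
  assumes "hh \<kappa> \<Sigma> \<Delta> (Atom A)" and "conv \<kappa> \<Sigma> Prop A B"
  shows "hh \<kappa> \<Sigma> \<Delta> (Atom B)"
  using assms(1) by cases (use assms(2) in \<open>blast intro: hh.BACKCHAIN conv_trans\<close>)

inductive_cases clause_inst_CAtomE: "clause_inst \<kappa> \<Sigma> (CAtom B) Gs A"
inductive_cases clause_inst_CImpE: "clause_inst \<kappa> \<Sigma> (CImp G D) Gs A"
inductive_cases clause_inst_CAllE: "clause_inst \<kappa> \<Sigma> (CAll \<tau> D) Gs A"

text \<open>
  The derivation of the cut atom uses its own context \<open>\<Delta>\<^sub>0\<close>: only this one has to be well formed,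
  because it is carried below eigenvariables, while \<open>\<Delta>\<close> may grow arbitrarily.
\<close>

lemma hh_cut_Atom:
  assumes "hh \<kappa> \<Sigma> \<Gamma> G" and "set \<Gamma> \<subseteq> insert (CAtom X) (set \<Delta>)" and "set \<Delta>\<^sub>0 \<subseteq> set \<Delta>"
    and "hh \<kappa> \<Sigma> \<Delta>\<^sub>0 (Atom X)" and "eigs X \<subseteq> dom \<Sigma>" and "\<forall>D\<in>set \<Delta>\<^sub>0. eigs_clause D \<subseteq> dom \<Sigma>"
    and "finite (dom \<Sigma>)"
  shows "hh \<kappa> \<Sigma> \<Delta> G"
  using assms
proof (induction arbitrary: \<Delta> rule: hh.induct)
  case (AUGMENT \<Sigma> A \<Gamma> G)
  have "hh \<kappa> \<Sigma> (CAtom A # \<Delta>) G"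
    by (rule AUGMENT.IH) (use AUGMENT.prems in auto)
  then show ?case by (rule hh.AUGMENT)
next
  case (GENERIC c \<Sigma> \<tau> \<Gamma> G)
  have "\<Sigma> \<subseteq>\<^sub>m \<Sigma>(c \<mapsto> \<tau>)" using GENERIC.hyps(1) by (auto simp: map_le_def)
  then have X: "hh \<kappa> (\<Sigma>(c \<mapsto> \<tau>)) \<Delta>\<^sub>0 (Atom X)"
    using GENERIC.prems by (intro hh_weaken_sig[OF GENERIC.prems(3)]) auto
  have "eigs X \<subseteq> dom (\<Sigma>(c \<mapsto> \<tau>))" "\<forall>D\<in>set \<Delta>\<^sub>0. eigs_clause D \<subseteq> dom (\<Sigma>(c \<mapsto> \<tau>))"
    "finite (dom (\<Sigma>(c \<mapsto> \<tau>)))"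
    using GENERIC.prems by auto
  then have "hh \<kappa> (\<Sigma>(c \<mapsto> \<tau>)) \<Delta> (subst_gform 0 (Eig c) G)"
    by (rule GENERIC.IH[OF GENERIC.prems(1,2) X])
  with GENERIC.hyps(1) show ?case by (rule hh.GENERIC)
next
  case (BACKCHAIN D \<Gamma> \<Sigma> Gs A' A)
  show ?case
  proof (cases "D = CAtom X")
    case True
    \<comment> \<open>A use of the cut hypothesis has no subgoals, so the given derivation of
      \<open>X\<close> replaces it, up to weakening and conversion.\<close>
    then have "A' = X" using BACKCHAIN.hyps(2) by (auto elim: clause_inst_CAtomE)
    then show ?thesis
      using BACKCHAIN.hyps(3) BACKCHAIN.prems(2,3) hh_Atom_conv hh_weaken by blast
  next
    case False
    then show ?thesis
      using BACKCHAIN by (intro hh.BACKCHAIN[of D \<Delta> \<kappa> \<Sigma> Gs A' A]) auto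
  qed
qed (blast intro: hh.intros)+

section \<open>Inversion for the encoding\<close>

lemmas clause_inst_elims = clause_inst_CAllE clause_inst_CImpE clause_inst_CAtomE

text \<open>Here and for the other three clauses: instantiating terms are closed, so substitution
  for the inner quantifiers leaves them alone and the instance can be computed.\<close>

lemma clause_inst_eval_abs:
  assumes "clause_inst stlc_sig \<Sigma> eval_abs_clause Gs E"
  obtains A M where "E = eval_tm (abs_tm A M) (abs_tm A M)"
  using assms unfolding eval_abs_clause_def Let_def
  by (auto simp: has_type_closed closed_lift closed_subst elim!: clause_inst_elims)

lemma clause_inst_eval_app:
  assumes "clause_inst stlc_sig \<Sigma> eval_app_clause Gs E"
  obtains M A R N V where "E = eval_tm (app M N) V"
    "Gs = [Atom (eval_tm M (abs_tm A R)), Atom (eval_tm (R \<bullet> N) V)]"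
    "has_type stlc_sig \<Sigma> [] M tm" "has_type stlc_sig \<Sigma> [] A tp"
    "has_type stlc_sig \<Sigma> [] R (tm \<rightarrow> tm)" "has_type stlc_sig \<Sigma> [] N tm"
    "has_type stlc_sig \<Sigma> [] V tm"
  using assms unfolding eval_app_clause_def Let_def
  by (auto simp: has_type_closed closed_lift closed_subst elim!: clause_inst_elims)

lemma clause_inst_of_app:
  assumes "clause_inst stlc_sig \<Sigma> of_app_clause Gs E"
  obtains M A B N where "E = of_tp (app M N) B"
    "Gs = [Atom (of_tp M (arr A B)), Atom (of_tp N A)]"
    "has_type stlc_sig \<Sigma> [] M tm" "has_type stlc_sig \<Sigma> [] A tp"
    "has_type stlc_sig \<Sigma> [] B tp" "has_type stlc_sig \<Sigma> [] N tm"
  using assms unfolding of_app_clause_def Let_def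
  by (auto simp: has_type_closed closed_lift closed_subst elim!: clause_inst_elims)

lemma clause_inst_of_abs:
  assumes "clause_inst stlc_sig \<Sigma> of_abs_clause Gs E"
  obtains A R B where "E = of_tp (abs_tm A R) (arr A B)"
    "Gs = [All tm (Imp (of_tp (Bnd 0) A) (Atom (of_tp (R \<bullet> Bnd 0) B)))]"
    "has_type stlc_sig \<Sigma> [] A tp" "has_type stlc_sig \<Sigma> [] R (tm \<rightarrow> tm)"
    "has_type stlc_sig \<Sigma> [] B tp"
  using assms unfolding of_abs_clause_def Let_def
  by (auto simp: has_type_closed closed_lift closed_subst elim!: clause_inst_elims)

lemma eigs_stlc_clauses: "D \<in> set stlc_clauses \<Longrightarrow> eigs_clause D = {}"
  by (auto simp: stlc_clauses_def eval_abs_clause_def eval_app_clause_def of_app_clause_def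
      of_abs_clause_def Let_def)

lemma conv_abs_app:
  assumes "conv stlc_sig \<Sigma> tm (abs_tm A R) (app M N)"
  shows False
  using conv_Const2_inject(1)[OF assms] by simp

text \<open>The head \<open>Of_c\<close> rules out the evaluation clauses, and injectivity splits
  the conversion of atoms. In the application case the argument type \<open>A\<close> is absent from
  the conclusion, so its typing is handed out separately.\<close>

lemma hh_of_cases:
  assumes "hh stlc_sig \<Sigma> stlc_clauses (Atom (of_tp e t))"
  obtains
    (app) M A B N where "conv stlc_sig \<Sigma> tm (app M N) e" "conv stlc_sig \<Sigma> tp B t"
      "has_type stlc_sig \<Sigma> [] A tp"
      "hh stlc_sig \<Sigma> stlc_clauses (Atom (of_tp M (arr A B)))"
      "hh stlc_sig \<Sigma> stlc_clauses (Atom (of_tp N A))"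
  | (abs) A R B where "conv stlc_sig \<Sigma> tm (abs_tm A R) e" "conv stlc_sig \<Sigma> tp (arr A B) t"
      "hh stlc_sig \<Sigma> stlc_clauses (All tm (Imp (of_tp (Bnd 0) A) (Atom (of_tp (R \<bullet> Bnd 0) B))))"
  using assms
proof cases
  case (BACKCHAIN D Gs E)
  consider "D = eval_abs_clause" | "D = eval_app_clause" | "D = of_app_clause" | "D = of_abs_clause"
    using BACKCHAIN(1) by (auto simp: stlc_clauses_def)
  then show ?thesis
  proof cases
    case 1
    then obtain a b where "E = eval_tm a b"
      using BACKCHAIN(2) by (auto elim: clause_inst_eval_abs)
    then show ?thesis using conv_Const2_inject(1) BACKCHAIN(3) by fastforce
  next
    case 2
    then obtain a b where "E = eval_tm a b"
      using BACKCHAIN(2) by (auto elim: clause_inst_eval_app)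
    then show ?thesis using conv_Const2_inject(1) BACKCHAIN(3) by fastforce
  next
    case 3
    from BACKCHAIN(2)[unfolded 3] show ?thesis
    proof (rule clause_inst_of_app)
      fix M A B N
      assume *: "E = of_tp (app M N) B" "Gs = [Atom (of_tp M (arr A B)), Atom (of_tp N A)]"
        "has_type stlc_sig \<Sigma> [] A tp"
      show ?thesis
        using conv_Const2_inject(2,3)[OF BACKCHAIN(3)[unfolded *(1)]] BACKCHAIN(4) *
        by (intro app) auto
    qed
  next
    case 4
    from BACKCHAIN(2)[unfolded 4] show ?thesis
    proof (rule clause_inst_of_abs)
      fix A R B
      assume *: "E = of_tp (abs_tm A R) (arr A B)"
        "Gs = [All tm (Imp (of_tp (Bnd 0) A) (Atom (of_tp (R \<bullet> Bnd 0) B)))]"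
      show ?thesis
        using conv_Const2_inject(2,3)[OF BACKCHAIN(3)[unfolded *(1)]] BACKCHAIN(4) *
        by (intro abs) auto
    qed
  qed
qed

text \<open>The substitution lemma of the encoded calculus, obtained from substitution and cut in
  the logic.\<close>

lemma hh_of_body_inst:
  assumes fin: "finite (dom \<Sigma>)"
    and gen: "hh stlc_sig \<Sigma> stlc_clauses
      (All tm (Imp (of_tp (Bnd 0) A) (Atom (of_tp (R \<bullet> Bnd 0) B))))"
    and A: "has_type stlc_sig \<Sigma> [] A tp" and R: "has_type stlc_sig \<Sigma> [] R (tm \<rightarrow> tm)"
    and B: "has_type stlc_sig \<Sigma> [] B tp" and N: "has_type stlc_sig \<Sigma> [] N tm"
    and NA: "hh stlc_sig \<Sigma> stlc_clauses (Atom (of_tp N A))"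
  shows "hh stlc_sig \<Sigma> stlc_clauses (Atom (of_tp (R \<bullet> N) B))"
proof -
  note closed = has_type_closed[OF A] has_type_closed[OF R] has_type_closed[OF B]
  note eigs = has_type_eigs[OF A] has_type_eigs[OF R] has_type_eigs[OF B] has_type_eigs[OF N]
  \<comment> \<open>Only GENERIC derives \<open>All\<close> and only AUGMENT derives
    \<open>Imp\<close>, so both can be inverted.\<close>
  obtain c where c: "c \<notin> dom \<Sigma>" and
    "hh stlc_sig (\<Sigma>(c \<mapsto> tm)) stlc_clauses
      (subst_gform 0 (Eig c) (Imp (of_tp (Bnd 0) A) (Atom (of_tp (R \<bullet> Bnd 0) B))))"
    using gen by cases
  then have body: "hh stlc_sig (\<Sigma>(c \<mapsto> tm)) (CAtom (of_tp (Eig c) A) # stlc_clauses)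
      (Atom (of_tp (R \<bullet> Eig c) B))"
    using closed by (auto simp: closed_subst elim: hh.cases)
  let ?\<theta> = "Eig(c := N)"
  have id: "eig_subst ?\<theta> M = M" if "eigs M \<subseteq> dom \<Sigma>" for M
  proof -
    have "eig_subst ?\<theta> M = eig_subst Eig M" using that c by (intro eig_subst_cong) auto
    then show ?thesis by (simp add: eig_subst_Eig)
  qed
  have "eig_subst_clause ?\<theta> D = D" if "D \<in> set stlc_clauses" for D
    using eig_subst_clause_cong[of D ?\<theta> Eig] eigs_stlc_clauses[OF that]
    by (simp add: eig_subst_clause_Eig)
  then have \<Delta>: "map (eig_subst_clause ?\<theta>) stlc_clauses = stlc_clauses" by (rule map_idI)
  \<comment> \<open>Replacing \<open>c\<close> by \<open>N\<close> turns the hypothesis into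
    \<open>of_tp N A\<close>, ready to be cut, and fixes the program.\<close>
  have "hh stlc_sig \<Sigma> (map (eig_subst_clause ?\<theta>) (CAtom (of_tp (Eig c) A) # stlc_clauses))
      (eig_subst_gform ?\<theta> (Atom (of_tp (R \<bullet> Eig c) B)))"
  proof (rule hh_eig_subst[OF body])
    show "closed (?\<theta> x)" for x using has_type_closed[OF N] by (simp add: closed_Eig)
    show "has_type stlc_sig \<Sigma> [] (?\<theta> x) \<tau>" if "(\<Sigma>(c \<mapsto> tm)) x = Some \<tau>" for x \<tau>
      using that N by (auto intro: ty_Eig split: if_splits)
  qed (use eigs fin eigs_stlc_clauses in auto)
  then have "hh stlc_sig \<Sigma> (CAtom (of_tp N A) # stlc_clauses) (Atom (of_tp (R \<bullet> N) B))"
    using eigs by (simp add: id \<Delta>)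
  then show ?thesis
    by (rule hh_cut_Atom[where \<Delta>\<^sub>0 = stlc_clauses and X = "of_tp N A"])
      (use NA eigs fin eigs_stlc_clauses in auto)
qed

section \<open>Type preservation\<close>

lemma conv_of:
  "conv stlc_sig \<Sigma> tm M M' \<Longrightarrow> conv stlc_sig \<Sigma> tp A A' \<Longrightarrow>
   conv stlc_sig \<Sigma> Prop (of_tp M A) (of_tp M' A')"
  by (rule conv_Const2) auto

text \<open>The derived atom \<open>E\<close> need only be convertible to
  \<open>eval_tm e v\<close>, since BACKCHAIN matches up to conversion. The equations for
  \<open>\<Delta>\<close> and \<open>G\<close> keep program and goal shape through the rule
  induction.\<close>

lemma hh_eval_preserves_of:
  assumes "hh stlc_sig \<Sigma> \<Delta> G" and "\<Delta> = stlc_clauses" and "G = Atom E" and "finite (dom \<Sigma>)"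
    and "conv stlc_sig \<Sigma> Prop E (eval_tm e v)"
    and "hh stlc_sig \<Sigma> stlc_clauses (Atom (of_tp e t))" and "has_type stlc_sig \<Sigma> [] t tp"
  shows "hh stlc_sig \<Sigma> stlc_clauses (Atom (of_tp v t))"
  using assms
proof (induction arbitrary: E e v t rule: hh.induct)
  case (BACKCHAIN D \<Delta> \<Sigma> Gs E' E\<^sub>0)
  let ?conv = "conv stlc_sig \<Sigma>" and ?hh = "hh stlc_sig \<Sigma> stlc_clauses"
    and ?ty = "has_type stlc_sig \<Sigma> []"
  have conv: "?conv Prop E' (eval_tm e v)"
    using BACKCHAIN.hyps(3) BACKCHAIN.prems(2,4) conv_trans by blast
  note of_e = BACKCHAIN.prems(5) and t = BACKCHAIN.prems(6) and fin = BACKCHAIN.prems(3)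
  consider "D = eval_abs_clause" | "D = eval_app_clause" | "D = of_app_clause" | "D = of_abs_clause"
    using BACKCHAIN.hyps(1) BACKCHAIN.prems(1) by (auto simp: stlc_clauses_def)
  then show ?case
  proof cases
    case 1
    then obtain A M where E': "E' = eval_tm (abs_tm A M) (abs_tm A M)"
      using BACKCHAIN.hyps(2) by (auto elim: clause_inst_eval_abs)
    \<comment> \<open>Both \<open>e\<close> and \<open>v\<close> are convertible to the same
      abstraction.\<close>
    have "?conv tm e v"
      using conv_Const2_inject(2,3)[OF conv[unfolded E']] by (auto intro: conv_sym conv_trans)
    then show ?thesis using of_e conv_of conv_refl[OF t] hh_Atom_conv by blast
  next
    case 2
    then obtain M A R N V where E': "E' = eval_tm (app M N) V"
      and Gs: "Gs = [Atom (eval_tm M (abs_tm A R)), Atom (eval_tm (R \<bullet> N) V)]"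
      and ty: "?ty M tm" "?ty A tp" "?ty R (tm \<rightarrow> tm)" "?ty N tm" "?ty V tm"
      using BACKCHAIN.hyps(2) by (auto elim: clause_inst_eval_app)
    have e: "?conv tm (app M N) e" and v: "?conv tm V v"
      using conv_Const2_inject(2,3)[OF conv[unfolded E']] by auto
    have abs_ty: "?ty (abs_tm A R) tm" and RN: "?ty (R \<bullet> N) tm"
      using ty by (auto intro: has_type_Const2 ty_App)
    have eval_M: "?conv Prop (eval_tm M (abs_tm A R)) (eval_tm M (abs_tm A R))"
      and eval_RN: "?conv Prop (eval_tm (R \<bullet> N) V) (eval_tm (R \<bullet> N) V)"
      using ty abs_ty RN by (auto intro!: conv_refl has_type_Const2)
    from of_e show ?thesis
    proof (cases rule: hh_of_cases)
      case (abs A' R' B)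
      \<comment> \<open>An application cannot have been typed by the clause for
        abstractions.\<close>
      then show ?thesis using e conv_abs_app conv_sym conv_trans by blast
    next
      case (app M' A' B N')
      have app_conv: "?conv tm (app M' N') (app M N)"
        using app(1) e conv_sym conv_trans by blast
      have MN: "?conv tm M' M" "?conv tm N' N"
        using conv_Const2_inject(2,3)[OF app_conv] by auto
      have arr: "?ty (arr A' B) tp"
        using app(3) conv_typeD(1)[OF app(2)] by (auto intro: has_type_Const2)
      have "?hh (Atom (of_tp M (arr A' B)))"
        using hh_Atom_conv[OF app(4) conv_of[OF MN(1) conv_refl[OF arr]]] .
      \<comment> \<open>Induction hypothesis for the evaluation of \<open>M\<close>, at the type
        given by inverting the typing of the application.\<close>
      then have "?hh (Atom (of_tp (abs_tm A R) (arr A' B)))"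
        using BACKCHAIN.IH BACKCHAIN.prems(1) Gs eval_M fin arr by auto
      then show ?thesis
      proof (cases rule: hh_of_cases)
        case (app M'' A'' B'' N'')
        then show ?thesis using conv_abs_app conv_sym by blast
      next
        case (abs A'' R'' B'')
        have AR: "?conv tp A'' A" "?conv (tm \<rightarrow> tm) R'' R"
          using conv_Const2_inject(2,3)[OF abs(1)] by auto
        have AB: "?conv tp A'' A'" "?conv tp B'' B"
          using conv_Const2_inject(2,3)[OF abs(2)] by auto
        \<comment> \<open>Injectivity of \<open>arr\<close> identifies the argument type
          \<open>A'\<close> with the domain \<open>A''\<close> of the abstraction, so
          \<open>N\<close> can be put into its body.\<close>
        have "?hh (Atom (of_tp N A''))"
          using hh_Atom_conv[OF app(5) conv_of[OF MN(2) conv_sym[OF AB(1)]]] .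
        then have "?hh (Atom (of_tp (R'' \<bullet> N) B''))"
          using hh_of_body_inst[OF fin abs(3)] AR AB ty(4) conv_typeD by blast
        then have "?hh (Atom (of_tp (R \<bullet> N) t))"
          using conv_of[OF conv_App[OF AR(2) conv_refl[OF ty(4)]] conv_trans[OF AB(2) app(2)]]
          by (rule hh_Atom_conv)
        \<comment> \<open>Induction hypothesis for the evaluation of the contracted redex
          \<open>R \<bullet> N\<close>.\<close>
        then have "?hh (Atom (of_tp V t))"
          using BACKCHAIN.IH BACKCHAIN.prems(1) Gs eval_RN fin t by auto
        then show ?thesis using conv_of[OF v conv_refl[OF t]] by (rule hh_Atom_conv)
      qed
    qed
  next
    case 3
    then obtain a b where "E' = of_tp a b"
      using BACKCHAIN.hyps(2) by (auto elim: clause_inst_of_app)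
    then show ?thesis using conv_Const2_inject(1) conv by fastforce
  next
    case 4
    then obtain a b where "E' = of_tp a b"
      using BACKCHAIN.hyps(2) by (auto elim: clause_inst_of_abs)
    then show ?thesis using conv_Const2_inject(1) conv by fastforce
  qed
qed auto

theorem theorem2p5:
  fixes \<Sigma> :: "stlc_base eigsig" and e v t :: stlc_trm
  assumes "finite (dom \<Sigma>)"
    and "has_type stlc_sig \<Sigma> [] e tm"
    and "has_type stlc_sig \<Sigma> [] v tm"
    and "has_type stlc_sig \<Sigma> [] t tp"
    and "hh stlc_sig \<Sigma> stlc_clauses (Atom (eval_tm e v))"
    and "hh stlc_sig \<Sigma> stlc_clauses (Atom (of_tp e t))"
  shows "hh stlc_sig \<Sigma> stlc_clauses (Atom (of_tp v t))"
proof (rule hh_eval_preserves_of[OF assms(5) refl refl assms(1) _ assms(6,4)])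
  show "conv stlc_sig \<Sigma> Prop (eval_tm e v) (eval_tm e v)"
    using assms(2,3) by (auto intro!: conv_refl has_type_Const2)
qed

end
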